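(* Let $\chi \in \widehat{\mathcal{O}^{\times}}$ and $m \geq c(\chi)$. The reproducing kernel for $\mathcal{H}_{\chi,m}(S^{n-1})$ is $(\dim \mathcal{H}_{\chi,m}(S^{n-1}))\, \tau_{\chi,m}(k^{-1}) \cdot P_{\chi,m}^{\circ}$, so that for all $P \in \mathcal{H}_{\chi,m}(S^{n-1})$ and $k \in K$, \[P(e_n k) = \dim \mathcal{H}_{\chi,m}(S^{n-1}) \left\langle \tau_{\chi,m}(k) \cdot P, P_{\chi,m}^{\circ}\right\rangle.\] In particular, \[\left\langle P_{\chi,m}^{\circ}, P_{\chi,m}^{\circ}\right\rangle = \frac{1}{\dim \mathcal{H}_{\chi,m}(S^{n-1})}.\]
   Context: Let $F$ be a nonarchimedean local field with ring of integers $\mathcal{O}$, maximal ideal $\mathfrak{p}$, uniformiser $\varpi$, residue field of order $q$, and absolute value normalised by $|\varpi| = q^{-1}$. Fix $n \geq 2$ and let $K = \mathrm{GL}_n(\mathcal{O})$ with Haar probability measure $dk$. Let \[K_{n-1,1} = \left\{\begin{pmatrix} a & b \\ 0 & 1\end{pmatrix} \in K : a \in \mathrm{GL}_{n-1}(\mathcal{O}),\ b \in \mathrm{Mat}_{(n-1)\times 1}(\mathcal{O})\right\}.\] Let $S^{n-1} = \{x \in F^n : \max\{|x_1|,\ldots,|x_n|\} = 1\}$ (row vectors), on which $K$ acts by $k \cdot x = xk$, and let $e_n = (0,\ldots,0,1)$. $C^{\infty}(S^{n-1})$ is the space of locally constant functions $f : S^{n-1} \to \mathbb{C}$, with inner product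 $\langle f_1,f_2\rangle = \int_K f_1(e_n k)\overline{f_2(e_n k)}\,dk$. For $m \geq 0$, $K(\mathfrak{p}^m) = \{k \in K : k - 1_n \in \mathrm{Mat}_{n\times n}(\mathfrak{p}^m)\}$. $\widehat{\mathcal{O}^{\times}}$ is the set of continuous characters $\chi : \mathcal{O}^{\times} \to \mathbb{C}^{\times}$. The conductor exponent $c(\chi)$ is the least nonnegative integer $m$ such that $\chi$ is trivial on $1+\mathfrak{p}^m$ (on $\mathcal{O}^{\times}$ if $m=0$). Let $C^{\infty}(S^{n-1})_{\chi}^{K(\mathfrak{p}^m)}$ be the space of $f \in C^{\infty}(S^{n-1})$ with $f(xk) = f(x)$ for all $k \in K(\mathfrak{p}^m)$ and $f(ax) = \chi(a) f(x)$ for all $a \in \mathcal{O}^{\times}$. For $m \geq c(\chi)$, $\mathcal{H}_{\chi,m}(S^{n-1})$ is $C^{\infty}(S^{n-1})_{\chi}^{K(\mathfrak{p}^{c(\chi)})}$ if $m = c(\chi)$, and the orthogonal complement of $C^{\infty}(S^{n-1})_{\chi}^{K(\mathfrak{p}^{m-1})}$ in $C^{\infty}(S^{n-1})_{\chi}^{K(\mathfrak{p}^m)}$ if $m > c(\chi)$; it is finite-dimensional. $\tau_{\chi,m}$ denotes the representation of $K$ on $\mathcal{H}_{\chi,m}(S^{n-1})$ by right translations, $(\tau_{\chi,m}(k)\cdot f)(x) = f(xk)$. $P_{\chi,m}^{\circ}$ denotes the unique function in $\mathcal{H}_{\chi,m}(S^{n-1})$ satisfying $P_{\chi,m}^{\circ}(xk')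 = P_{\chi,m}^{\circ}(x)$ for all $x \in S^{n-1}$, $k' \in K_{n-1,1}$, and $P_{\chi,m}^{\circ}(e_n) = 1$. The reproducing kernel at the point $e_n k$ is the element of $\mathcal{H}_{\chi,m}(S^{n-1})$ whose inner product against $P$ (with $P$ in the first slot) gives $P(e_n k)$. *)

theory Defs
  imports "HOL-Probability.Probability" "HOL-Library.Function_Algebras"
begin

section \<open>Nonarchimedean local fields\<close>

text \<open>
  A field that is complete for a discretely valued nonarchimedean absolute value with finite
  residue field, together with a chosen uniformiser \<open>unif\<close>. The absolute value is normalised so
  that \<open>absv unif\<close> is the reciprocal of the order of the residue field. The metric is the one
  defined by the absolute value, so \<open>open\<close>, \<open>continuous_on\<close> and \<open>borel\<close> refer to the valuation
  topology, and on \<open>'a ^ 'n\<close> and \<open>'a ^ 'n ^ 'n\<close> to the product topology. Completeness comes from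
  \<open>complete_space\<close>.
\<close>

class nonarch_local_field = field + complete_space +
  fixes absv :: "'a \<Rightarrow> real"
    and unif :: "'a"
  assumes dist_absv: "dist x y = absv (x - y)"
    and absv_mult: "absv (x * y) = absv x * absv y"
    and absv_ultrametric: "absv (x + y) \<le> max (absv x) (absv y)"
    and unif_generates: "absv x < 1 \<longleftrightarrow> (\<exists>y. absv y \<le> 1 \<and> x = unif * y)"
    and finite_residue_field:
      "finite ({x. absv x \<le> 1} // {(x, y). absv x \<le> 1 \<and> absv y \<le> 1 \<and> absv (x - y) < 1})"
    and absv_unif:
      "absv unif = 1 / real (card
        ({x. absv x \<le> 1} // {(x, y). absv x \<le> 1 \<and> absv y \<le> 1 \<and> absv (x - y) < 1}))"

definition int_ring :: "'a::nonarch_local_field set" where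
  "int_ring = {x. absv x \<le> 1}"

definition int_units :: "'a::nonarch_local_field set" where
  "int_units = {a \<in> int_ring. \<exists>b\<in>int_ring. a * b = 1}"

definition max_ideal_power :: "nat \<Rightarrow> 'a::nonarch_local_field set" where
  "max_ideal_power m = {unif ^ m * y | y. y \<in> int_ring}"


section \<open>Characters of the unit group\<close>

text \<open>Only the values of a character on \<open>int_units\<close> are relevant.\<close>

definition unit_characters :: "('a::nonarch_local_field \<Rightarrow> complex) set" where
  "unit_characters = {\<omega>. continuous_on int_units \<omega> \<and> (\<forall>a\<in>int_units. \<omega> a \<noteq> 0) \<and>
     (\<forall>a\<in>int_units. \<forall>b\<in>int_units. \<omega> (a * b) = \<omega> a * \<omega> b)}"

definition cond_exp :: "('a::nonarch_local_field \<Rightarrow> complex) \<Rightarrow> nat" where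
  "cond_exp \<omega> = (LEAST m. if m = 0 then \<forall>a\<in>int_units. \<omega> a = 1
     else \<forall>x\<in>max_ideal_power m. \<omega> (1 + x) = 1)"


section \<open>The group K and its subgroups\<close>

text \<open>
  The index type \<open>'n\<close> is linearly ordered, so \<open>n = CARD('n)\<close> and the last index is \<open>Max UNIV\<close>.
\<close>

definition last_index :: "'n::{finite,linorder}" where
  "last_index = Max UNIV"

definition int_mats :: "('a::nonarch_local_field ^ 'n ^ 'n) set" where
  "int_mats = {A. \<forall>i j. A $ i $ j \<in> int_ring}"

definition GLO :: "('a::nonarch_local_field ^ 'n ^ 'n) set" where
  "GLO = {A \<in> int_mats. \<exists>B\<in>int_mats. A ** B = mat 1 \<and> B ** A = mat 1}"

definition congruence_subgroup :: "nat \<Rightarrow> ('a::nonarch_local_field ^ 'n ^ 'n) set" where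
  "congruence_subgroup m = {k \<in> GLO. \<forall>i j. (k - mat 1) $ i $ j \<in> max_ideal_power m}"

text \<open>
  The block of \<open>A\<close> obtained by deleting the last row and column is invertible over the ring of
  integers; the last row and column of the witness \<open>B\<close> play no role.
\<close>

definition upper_left_block_GLO ::
    "'a::nonarch_local_field ^ 'n::{finite,linorder} ^ 'n::{finite,linorder} \<Rightarrow> bool" where
  "upper_left_block_GLO A \<longleftrightarrow>
     (\<forall>i j. i \<noteq> last_index \<and> j \<noteq> last_index \<longrightarrow> A $ i $ j \<in> int_ring) \<and>
     (\<exists>B\<in>int_mats. \<forall>i j. i \<noteq> last_index \<and> j \<noteq> last_index \<longrightarrow>
        (\<Sum>l\<in>UNIV - {last_index}. A $ i $ l * B $ l $ j) = (if i = j then 1 else 0) \<and>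
        (\<Sum>l\<in>UNIV - {last_index}. B $ i $ l * A $ l $ j) = (if i = j then 1 else 0))"

definition mirabolic :: "('a::nonarch_local_field ^ 'n::{finite,linorder} ^ 'n::{finite,linorder}) set" where
  "mirabolic = {k \<in> GLO. upper_left_block_GLO k \<and>
     (\<forall>i. i \<noteq> last_index \<longrightarrow> k $ i $ last_index \<in> int_ring) \<and>
     (\<forall>j. k $ last_index $ j = (if j = last_index then 1 else 0))}"

text \<open>On the compact group K such a measure exists and is unique.\<close>

definition haar_prob :: "('a::nonarch_local_field ^ 'n ^ 'n) measure \<Rightarrow> bool" where
  "haar_prob M \<longleftrightarrow> prob_space M \<and> sets M = sets (restrict_space borel GLO) \<and>
     (\<forall>g\<in>GLO. \<forall>A\<in>sets M. emeasure M ((\<lambda>k. g ** k) ` A) = emeasure M A)"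


section \<open>Functions on the unit sphere\<close>

definition last_basis :: "'a::nonarch_local_field ^ 'n::{finite,linorder}" where
  "last_basis = axis last_index 1"

definition unit_sphere :: "('a::nonarch_local_field ^ 'n) set" where
  "unit_sphere = {x. Max (range (\<lambda>i. absv (x $ i))) = 1}"

text \<open>
  A function on the sphere is represented by its extension by zero to the whole of \<open>'a ^ 'n\<close>, so
  that functions equal on the sphere are equal.
\<close>

definition smooth_fun :: "('a::nonarch_local_field ^ 'n \<Rightarrow> complex) set" where
  "smooth_fun = {f. (\<forall>x. x \<notin> unit_sphere \<longrightarrow> f x = 0) \<and>
     (\<forall>x\<in>unit_sphere. \<exists>U. open U \<and> x \<in> U \<and> f constant_on (U \<inter> unit_sphere))}"

definition sphere_inner ::
    "('a::nonarch_local_field ^ 'n::{finite,linorder} ^ 'n::{finite,linorder}) measure \<Rightarrow>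
    ('a ^ 'n::{finite,linorder} \<Rightarrow> complex) \<Rightarrow> ('a ^ 'n::{finite,linorder} \<Rightarrow> complex) \<Rightarrow> complex" where
  "sphere_inner M f1 f2 = (LINT k|M. f1 (last_basis v* k) * cnj (f2 (last_basis v* k)))"

definition smooth_fun_char_level ::
    "('a::nonarch_local_field \<Rightarrow> complex) \<Rightarrow> nat \<Rightarrow> ('a ^ 'n \<Rightarrow> complex) set" where
  "smooth_fun_char_level \<omega> m = {f \<in> smooth_fun.
     (\<forall>x\<in>unit_sphere. \<forall>k\<in>congruence_subgroup m. f (x v* k) = f x) \<and>
     (\<forall>x\<in>unit_sphere. \<forall>a\<in>int_units. f (a *s x) = \<omega> a * f x)}"

text \<open>Meaningful only for \<open>m \<ge> cond_exp \<omega>\<close>.\<close>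

definition level_space ::
    "('a::nonarch_local_field ^ 'n::{finite,linorder} ^ 'n::{finite,linorder}) measure \<Rightarrow>
    ('a \<Rightarrow> complex) \<Rightarrow> nat \<Rightarrow> ('a ^ 'n::{finite,linorder} \<Rightarrow> complex) set" where
  "level_space M \<omega> m = (if m = cond_exp \<omega> then smooth_fun_char_level \<omega> m
     else {f \<in> smooth_fun_char_level \<omega> m.
             \<forall>g\<in>smooth_fun_char_level \<omega> (m - 1). sphere_inner M f g = 0})"

definition right_translate :: "'a::nonarch_local_field ^ 'n ^ 'n \<Rightarrow>
    ('a ^ 'n \<Rightarrow> complex) \<Rightarrow> 'a ^ 'n \<Rightarrow> complex" where
  "right_translate k f = (\<lambda>x. f (x v* k))"

definition cscale :: "complex \<Rightarrow> ('b \<Rightarrow> complex) \<Rightarrow> 'b \<Rightarrow> complex" where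
  "cscale c f = (\<lambda>x. c * f x)"

lemma vector_space_cscale: "vector_space cscale"
  by unfold_locales (auto simp: cscale_def fun_eq_iff algebra_simps)

abbreviation cdim :: "('b \<Rightarrow> complex) set \<Rightarrow> nat" where
  "cdim \<equiv> vector_space.dim cscale"

definition spherical_fun ::
    "('a::nonarch_local_field ^ 'n::{finite,linorder} ^ 'n::{finite,linorder}) measure \<Rightarrow>
    ('a \<Rightarrow> complex) \<Rightarrow> nat \<Rightarrow> 'a ^ 'n::{finite,linorder} \<Rightarrow> complex" where
  "spherical_fun M \<omega> m = (THE f. f \<in> level_space M \<omega> m \<and>
     (\<forall>x\<in>unit_sphere. \<forall>k\<in>mirabolic. f (x v* k) = f x) \<and> f last_basis = 1)"

definition reproducing_kernel_at ::
    "('a::nonarch_local_field ^ 'n::{finite,linorder} ^ 'n::{finite,linorder}) measure \<Rightarrow>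
    ('a ^ 'n::{finite,linorder} \<Rightarrow> complex) set \<Rightarrow> 'a ^ 'n::{finite,linorder} \<Rightarrow>
    ('a ^ 'n::{finite,linorder} \<Rightarrow> complex) \<Rightarrow> bool" where
  "reproducing_kernel_at M H x Z \<longleftrightarrow> Z \<in> H \<and> (\<forall>P\<in>H. sphere_inner M P Z = P x)"

end

theory Submission
  imports Defs
begin

text \<open>
  Let \<open>Z\<close> be the reproducing kernel at \<open>last_basis\<close> of the finite-dimensional space
  \<open>level_space M \<omega> m\<close>. It is fixed by \<open>mirabolic\<close>, the stabiliser of \<open>last_basis\<close>, and its
  value at \<open>last_basis\<close> is the dimension, by integrating the kernel over the diagonal. A
  \<open>mirabolic\<close>-invariant function in the space that vanishes at \<open>last_basis\<close> is zero, so the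
  spherical function is \<open>Z\<close> divided by the dimension. For the latter claim one uses that two vectors
  \<open>x\<close> and \<open>y\<close> lie in one \<open>mirabolic\<close>-orbit as soon as their first \<open>n - 1\<close> coordinates have the
  same maximum norm \<open>c\<close> and their last coordinates differ by at most \<open>c\<close>. Functions invariant under a
  congruence subgroup only see a finite quotient of \<open>GLO\<close>, which turns all integrals into finite
  averages.
\<close>

section \<open>Absolute value and integral matrices\<close>

text \<open>The spherical function is a definite description, so existence and uniqueness must both
  be earned before anything can be said about it. Existence comes from dividing by the dimension,
  which requires the space to be nonzero; this is where a concrete function,
  \<open>char_fun\<close>, is needed. Uniqueness is a vanishing statement whose reason changes with
  the level. At the conductor, a unit on which the character is nontrivial can be absorbed by a
  mirabolic move. The assumption \<open>n \<ge> 2\<close> supplies a coordinate other than the last;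
  for \<open>n = 1\<close> the spaces above the conductor would be zero. No irreducibility enters:
  the kernel is constant on the diagonal because \<open>GLO\<close> acts transitively on the sphere
  and unitarily on functions.\<close>

lemma absv_nonneg [simp]: "0 \<le> absv (x::'a::nonarch_local_field)"
  using dist_absv[of x 0] zero_le_dist[of x 0] by simp

lemma absv_eq_0_iff [simp]: "absv (x::'a::nonarch_local_field) = 0 \<longleftrightarrow> x = 0"
  using dist_absv[of x 0] by (metis diff_zero dist_eq_0_iff)

lemma absv_0 [simp]: "absv (0::'a::nonarch_local_field) = 0"
  by simp

lemma absv_1 [simp]: "absv (1::'a::nonarch_local_field) = 1"
  using absv_mult[of "1::'a" 1] absv_eq_0_iff[of "1::'a"] by simp

lemma absv_minus_commute: "absv (x - y) = absv (y - x::'a::nonarch_local_field)"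
  by (metis dist_absv dist_commute)

lemma absv_minus [simp]: "absv (- x) = absv (x::'a::nonarch_local_field)"
  using absv_minus_commute[of 0 x] by simp

lemma absv_add_le: "absv x \<le> c \<Longrightarrow> absv y \<le> c \<Longrightarrow> absv (x + y::'a::nonarch_local_field) \<le> c"
  using absv_ultrametric[of x y] by linarith

lemma absv_diff_le: "absv x \<le> c \<Longrightarrow> absv y \<le> c \<Longrightarrow> absv (x - y::'a::nonarch_local_field) \<le> c"
  using absv_add_le[of x c "-y"] by simp

lemma absv_eq_of_diff_less:
  "absv (x - y) < absv y \<Longrightarrow> absv x = absv (y::'a::nonarch_local_field)"
  using absv_ultrametric[of "x - y" y] absv_ultrametric[of "y - x" x] absv_minus_commute[of x y]
  by auto

lemma absv_sum_le:
  "(\<And>i. i \<in> S \<Longrightarrow> absv (f i) \<le> c) \<Longrightarrow> 0 \<le> c \<Longrightarrow> absv (sum f S) \<le> (c::real)"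
  for f :: "'b \<Rightarrow> 'a::nonarch_local_field"
  by (induction S rule: infinite_finite_induct) (auto intro: absv_add_le)

lemma absv_power [simp]: "absv (x ^ m) = absv (x::'a::nonarch_local_field) ^ m"
  by (induction m) (auto simp: absv_mult)

lemma absv_inverse [simp]: "absv (inverse x) = inverse (absv (x::'a::nonarch_local_field))"
proof (cases "x = 0")
  case False
  then have "absv x * absv (inverse x) = 1"
    by (metis absv_1 absv_mult right_inverse)
  then show ?thesis
    by (metis inverse_unique)
qed simp

lemma absv_divide [simp]: "absv (x / y) = absv x / absv (y::'a::nonarch_local_field)"
  by (simp add: divide_inverse absv_mult)

abbreviation residue_rel :: "('a::nonarch_local_field \<times> 'a) set" where
  "residue_rel \<equiv> {(x, y). absv x \<le> 1 \<and> absv y \<le> 1 \<and> absv (x - y) < 1}"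

text \<open>\<open>absv_unif\<close> is the reciprocal of a cardinality, which is positive because
  the residue classes are finitely many and include that of 0; an infinite set would have
  \<open>card\<close> 0.\<close>

lemma absv_unif_pos: "0 < absv (unif::'a::nonarch_local_field)"
proof -
  let ?R = "{x::'a. absv x \<le> 1} // residue_rel"
  have "residue_rel `` {0::'a} \<in> ?R"
    by (rule quotientI) simp
  then have "?R \<noteq> {}"
    by (rule ex_in_conv[THEN iffD1, OF exI])
  then have "0 < card ?R"
    unfolding card_gt_0_iff using finite_residue_field by (rule conjI)
  then show ?thesis
    unfolding absv_unif by simp
qed

lemma absv_unif_less_1: "absv (unif::'a::nonarch_local_field) < 1"
  unfolding unif_generates by (rule exI[of _ 1]) simp

lemma unif_nonzero [simp]: "(unif::'a::nonarch_local_field) \<noteq> 0"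
  using absv_unif_pos[where 'a='a] by auto

text \<open>Discreteness of the valuation: \<open>unif\<close> generates the maximal ideal, so no
  absolute value lies strictly between that of \<open>unif\<close> and 1.\<close>

lemma absv_less_1_iff: "absv (x::'a::nonarch_local_field) < 1 \<longleftrightarrow> absv x \<le> absv (unif::'a)"
proof
  assume "absv x < 1"
  then obtain y where "absv y \<le> 1" "x = unif * y"
    using unif_generates by blast
  then show "absv x \<le> absv (unif::'a)"
    using mult_left_mono[of "absv y" 1 "absv (unif::'a)"] by (simp add: absv_mult)
next
  assume "absv x \<le> absv (unif::'a)"
  then show "absv x < 1"
    using absv_unif_less_1[where 'a='a] by linarith
qed

text \<open>The same gap, rescaled by \<open>unif ^ m\<close>. It turns the failure of a bound at
  level \<open>Suc m\<close> into a lower bound at level \<open>m\<close>, the form in which pivots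
  are found later.\<close>

lemma absv_greater_unif_power:
  assumes "absv (unif::'a) ^ Suc m < absv (x::'a::nonarch_local_field)"
  shows "absv (unif::'a) ^ m \<le> absv x"
proof (rule ccontr)
  assume "\<not> ?thesis"
  then have "absv (x / unif ^ m) < 1"
    using absv_unif_pos[where 'a='a] by (simp add: divide_simps)
  then have "absv x / absv (unif::'a) ^ m \<le> absv (unif::'a)"
    by (subst (asm) absv_less_1_iff) simp
  then show False
    using assms absv_unif_pos[where 'a='a] by (simp add: divide_simps)
qed

lemma unif_power_le_1 [simp]: "absv (unif::'a::nonarch_local_field) ^ m \<le> 1"
  using absv_unif_less_1[where 'a='a] by (simp add: power_le_one)

lemma unif_power_antimono:
  "m \<le> m' \<Longrightarrow> absv (unif::'a::nonarch_local_field) ^ m' \<le> absv (unif::'a) ^ m"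
  using absv_unif_less_1[where 'a='a] by (intro power_decreasing) auto

section \<open>The ring of integers, its units, and integral matrices\<close>

lemma int_ring_iff: "x \<in> int_ring \<longleftrightarrow> absv x \<le> 1"
  by (simp add: int_ring_def)

lemma max_ideal_power_iff:
  "x \<in> max_ideal_power m \<longleftrightarrow> absv (x::'a::nonarch_local_field) \<le> absv (unif::'a) ^ m"
proof
  assume "x \<in> max_ideal_power m"
  then show "absv x \<le> absv (unif::'a) ^ m"
    by (auto simp: max_ideal_power_def int_ring_def absv_mult mult_left_le)
next
  assume "absv x \<le> absv (unif::'a) ^ m"
  moreover have "x = unif ^ m * (x / unif ^ m)"
    by simp
  ultimately show "x \<in> max_ideal_power m"
    unfolding max_ideal_power_def int_ring_def using absv_unif_pos[where 'a='a]
    by (intro CollectI exI[of _ "x / unif ^ m"]) (simp add: divide_simps)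
qed

lemma int_units_iff: "a \<in> int_units \<longleftrightarrow> absv a = 1"
proof
  assume "a \<in> int_units"
  then obtain b where b: "absv a \<le> 1" "absv b \<le> 1" "a * b = 1"
    by (auto simp: int_units_def int_ring_def)
  then have "absv a * absv b = 1"
    by (metis absv_1 absv_mult)
  then show "absv a = 1"
    using b by (metis absv_nonneg antisym mult_left_le)
next
  assume "absv a = 1"
  moreover from this have "a * inverse a = 1"
    by (intro right_inverse) auto
  ultimately show "a \<in> int_units"
    by (auto simp: int_units_def int_ring_def intro!: exI[of _ "inverse a"])
qed

lemma int_mats_iff: "A \<in> int_mats \<longleftrightarrow> (\<forall>i j. absv (A $ i $ j) \<le> 1)"
  by (simp add: int_mats_def int_ring_iff)

lemma int_mats_mult: "A \<in> int_mats \<Longrightarrow> B \<in> int_mats \<Longrightarrow> A ** B \<in> int_mats"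
  by (auto simp: int_mats_iff matrix_matrix_mult_def absv_mult intro!: absv_sum_le mult_le_one)

lemma int_mats_one [simp]: "mat 1 \<in> int_mats"
  by (simp add: int_mats_iff mat_def)

lemma GLO_int_mats: "A \<in> GLO \<Longrightarrow> A \<in> int_mats"
  by (simp add: GLO_def)

lemma GLO_I: "A \<in> int_mats \<Longrightarrow> B \<in> int_mats \<Longrightarrow> A ** B = mat 1 \<Longrightarrow> A \<in> GLO"
  unfolding GLO_def using matrix_left_right_inverse by blast

lemma GLO_one [simp]: "mat 1 \<in> GLO"
  by (rule GLO_I[of _ "mat 1"]) auto

lemma GLO_mult [simp]:
  assumes "A \<in> GLO" "B \<in> GLO"
  shows "A ** B \<in> GLO"
proof -
  obtain A' B' where inv: "A' \<in> int_mats" "A ** A' = mat 1" "B' \<in> int_mats" "B ** B' = mat 1"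
    using assms by (auto simp: GLO_def)
  have "(A ** B) ** (B' ** A') = A ** (B ** B') ** A'"
    by (simp add: matrix_mul_assoc)
  then show ?thesis
    using assms inv by (intro GLO_I[of "A ** B" "B' ** A'"] int_mats_mult) (auto simp: GLO_int_mats)
qed

lemma
  assumes "A \<in> GLO"
  shows GLO_inv [simp]: "matrix_inv A \<in> GLO"
    and GLO_inv_right [simp]: "A ** matrix_inv A = mat 1"
    and GLO_inv_left [simp]: "matrix_inv A ** A = mat 1"
proof -
  obtain B where B: "B \<in> int_mats" "A ** B = mat 1" "B ** A = mat 1"
    using assms by (auto simp: GLO_def)
  then have "\<exists>B. A ** B = mat 1 \<and> B ** A = mat 1"
    by blast
  then have "A ** matrix_inv A = mat 1 \<and> matrix_inv A ** A = mat 1"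
    unfolding matrix_inv_def by (rule someI_ex)
  then show inv: "A ** matrix_inv A = mat 1" "matrix_inv A ** A = mat 1"
    by auto
  \<comment> \<open>\<open>matrix_inv\<close> is taken over the field; uniqueness of inverses
    identifies it with the integral witness \<open>B\<close>.\<close>
  have "matrix_inv A = matrix_inv A ** (A ** B)"
    by (simp add: B)
  also have "\<dots> = B"
    unfolding matrix_mul_assoc by (simp add: inv)
  finally show "matrix_inv A \<in> GLO"
    using B GLO_I[of B A] GLO_int_mats[OF assms] by simp
qed

lemma GLO_inv_mult_cancel [simp]:
  assumes "A \<in> GLO"
  shows "A ** (matrix_inv A ** B) = B" "matrix_inv A ** (A ** B) = B"
    "B ** A ** matrix_inv A = B" "B ** matrix_inv A ** A = B"
  using assms by (simp_all add: matrix_mul_assoc) (simp_all flip: matrix_mul_assoc)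

lemma GLO_vec_cancel [simp]:
  "A \<in> GLO \<Longrightarrow> x v* A v* matrix_inv A = x" "A \<in> GLO \<Longrightarrow> x v* matrix_inv A v* A = x"
  by (simp_all add: vector_matrix_mul_assoc)

subsection \<open>Congruence modulo powers of the maximal ideal\<close>

definition mat_cong :: "nat \<Rightarrow> 'a::nonarch_local_field ^ 'n ^ 'n \<Rightarrow> 'a ^ 'n ^ 'n \<Rightarrow> bool" where
  "mat_cong m A B \<longleftrightarrow> (\<forall>i j. absv (A $ i $ j - B $ i $ j) \<le> absv (unif::'a) ^ m)"

lemma mat_cong_refl [simp]: "mat_cong m A A"
  by (simp add: mat_cong_def)

lemma mat_cong_sym: "mat_cong m A B \<Longrightarrow> mat_cong m B A"
  by (simp add: mat_cong_def absv_minus_commute)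

lemma mat_cong_trans:
  fixes A B C :: "'a::nonarch_local_field ^ 'n ^ 'n"
  assumes "mat_cong m A B" "mat_cong m B C" shows "mat_cong m A C"
  unfolding mat_cong_def
proof (intro allI)
  fix i j
  show "absv (A $ i $ j - C $ i $ j) \<le> absv (unif::'a) ^ m"
    using assms absv_add_le[of "A $ i $ j - B $ i $ j" _ "B $ i $ j - C $ i $ j"]
    by (simp add: mat_cong_def)
qed

lemma mat_cong_mult_left:
  "A \<in> int_mats \<Longrightarrow> mat_cong m B C \<Longrightarrow> mat_cong m (A ** B) (A ** C)"
  unfolding mat_cong_def int_mats_iff matrix_matrix_mult_def
  by (auto simp: absv_mult mult_left_le_one_le order_trans[OF mult_left_le_one_le]
      simp flip: sum_subtractf right_diff_distrib intro!: absv_sum_le)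

lemma mat_cong_mult_right:
  "A \<in> int_mats \<Longrightarrow> mat_cong m B C \<Longrightarrow> mat_cong m (B ** A) (C ** A)"
  unfolding mat_cong_def int_mats_iff matrix_matrix_mult_def
  by (auto simp: absv_mult order_trans[OF mult_right_le_one_le]
      simp flip: sum_subtractf left_diff_distrib intro!: absv_sum_le)

lemma mat_cong_cancel_left:
  "g \<in> GLO \<Longrightarrow> mat_cong m (g ** A) (g ** B) \<longleftrightarrow> mat_cong m A B"
  using mat_cong_mult_left[of "matrix_inv g" m "g ** A" "g ** B"] mat_cong_mult_left[of g m A B]
  by (auto simp: GLO_int_mats)

lemma mat_cong_cancel_right:
  "g \<in> GLO \<Longrightarrow> mat_cong m (A ** g) (B ** g) \<longleftrightarrow> mat_cong m A B"
  using mat_cong_mult_right[of "matrix_inv g" m "A ** g" "B ** g"] mat_cong_mult_right[of g m A B]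
  by (auto simp: GLO_int_mats)

lemma congruence_subgroup_iff:
  "k \<in> congruence_subgroup m \<longleftrightarrow> k \<in> GLO \<and> mat_cong m k (mat 1)"
  by (simp add: congruence_subgroup_def mat_cong_def max_ideal_power_iff)

lemma congruence_subgroup_antimono:
  "m \<le> m' \<Longrightarrow> congruence_subgroup m' \<subseteq> (congruence_subgroup m :: ('a::nonarch_local_field ^ 'n ^ 'n) set)"
  using unif_power_antimono[of m m', where 'a='a]
  by (simp add: congruence_subgroup_iff mat_cong_def subset_eq Ball_def) (meson order_trans)

lemma congruence_subgroup_0: "congruence_subgroup 0 = GLO"
proof -
  have "mat_cong 0 k (mat 1)" if "k \<in> GLO" for k :: "'a ^ 'n ^ 'n"
  proof -
    have "mat 1 \<in> (int_mats :: ('a ^ 'n ^ 'n) set)" "k \<in> int_mats"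
      using that by (auto simp: GLO_int_mats)
    then show ?thesis
      by (auto simp: mat_cong_def int_mats_iff intro!: absv_diff_le)
  qed
  then show ?thesis
    by (auto simp: congruence_subgroup_iff)
qed

text \<open>Normality of the congruence subgroup, the reason why right translation keeps
  \<open>inv_fun m\<close> stable.\<close>

lemma congruence_subgroup_conj:
  assumes "g \<in> GLO" "k \<in> congruence_subgroup m"
  shows "matrix_inv g ** k ** g \<in> congruence_subgroup m"
proof -
  have "mat_cong m (matrix_inv g ** k ** g) (matrix_inv g ** mat 1 ** g)"
    using assms unfolding mat_cong_cancel_right[OF assms(1)] mat_cong_cancel_left[OF GLO_inv[OF assms(1)]]
    by (simp add: congruence_subgroup_iff)
  then show ?thesis
    using assms by (simp add: congruence_subgroup_iff)
qed

lemma mat_cong_imp_congruence_subgroup: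
  assumes "k \<in> GLO" "k' \<in> GLO" "mat_cong m k k'"
  obtains h where "h \<in> congruence_subgroup m" "k' = k ** h"
proof
  have "mat_cong m (matrix_inv k ** k') (matrix_inv k ** k)"
    using assms mat_cong_cancel_left[of "matrix_inv k" m k' k] by (simp add: mat_cong_sym)
  then show "matrix_inv k ** k' \<in> congruence_subgroup m"
    using assms by (simp add: congruence_subgroup_iff)
qed (use assms in simp)

section \<open>The unit sphere\<close>

lemma unit_sphere_iff:
  "x \<in> unit_sphere \<longleftrightarrow> (\<forall>i. absv (x $ i) \<le> 1) \<and> (\<exists>i. absv (x $ i) = 1)"
proof -
  have "Max (range (\<lambda>i. absv (x $ i))) = 1 \<longleftrightarrow>
    1 \<in> range (\<lambda>i. absv (x $ i)) \<and> (\<forall>a\<in>range (\<lambda>i. absv (x $ i)). a \<le> 1)"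
    by (rule Max_eq_iff) auto
  then show ?thesis
    unfolding unit_sphere_def by (auto simp: image_iff)
qed

lemma last_basis_nth: "last_basis $ i = (if i = last_index then 1 else 0)"
  by (auto simp: last_basis_def axis_def)

lemma last_basis_sphere [simp]: "last_basis \<in> unit_sphere"
  by (auto simp: unit_sphere_iff last_basis_nth)

lemma absv_vec_mat_le:
  assumes "A \<in> int_mats" "\<And>i. absv (x $ i) \<le> c" "0 \<le> c"
  shows "absv ((x v* A) $ j) \<le> c"
  using assms unfolding vector_matrix_mult_def int_mats_iff
  by (auto simp: absv_mult order_trans[OF mult_right_le_one_le] intro!: absv_sum_le)

lemma vec_mat_sphere:
  assumes "k \<in> GLO" "x \<in> unit_sphere"
  shows "x v* k \<in> unit_sphere"
proof -
  have le: "absv ((x v* k) $ i) \<le> 1" for i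
    using assms by (intro absv_vec_mat_le) (auto simp: GLO_int_mats unit_sphere_iff)
  have "\<exists>i. absv ((x v* k) $ i) = 1"
  proof (rule ccontr)
    \<comment> \<open>If every coordinate were below 1, discreteness would bound them all by
      \<open>absv unif\<close>, and the integral inverse of \<open>k\<close> would carry this bound
      back to \<open>x\<close>.\<close>
    assume "\<not> ?thesis"
    then have "absv ((x v* k) $ i) < 1" for i
      using le[of i] by (auto simp: less_le)
    then have "absv ((x v* k) $ i) \<le> absv (unif::'a)" for i
      unfolding absv_less_1_iff .
    then have "absv ((x v* k v* matrix_inv k) $ i) \<le> absv (unif::'a)" for i
      using assms(1) by (intro absv_vec_mat_le[of "matrix_inv k" "x v* k"]) (auto simp: GLO_int_mats)
    then have "absv (x $ i) < 1" for i
      using assms(1) absv_unif_less_1[where 'a='a] by (auto intro: le_less_trans)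
    then show False
      using assms(2) by (auto simp: unit_sphere_iff less_le)
  qed
  then show ?thesis
    using le by (simp add: unit_sphere_iff)
qed

lemma vec_mat_sphere_iff [simp]: "k \<in> GLO \<Longrightarrow> x v* k \<in> unit_sphere \<longleftrightarrow> x \<in> unit_sphere"
  using vec_mat_sphere[of k x] vec_mat_sphere[of "matrix_inv k" "x v* k"] by auto

lemma scale_sphere_iff [simp]: "absv a = 1 \<Longrightarrow> a *s x \<in> unit_sphere \<longleftrightarrow> x \<in> unit_sphere"
  by (simp add: unit_sphere_iff absv_mult)

lemma mirabolic_GLO: "k \<in> mirabolic \<Longrightarrow> k \<in> GLO"
  by (simp add: mirabolic_def)

lemma last_basis_mult: "last_basis v* k = k $ last_index"
  by (simp add: vec_eq_iff vector_matrix_mult_def last_basis_nth if_distrib if_distribR cong: if_cong)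

lemma mirabolic_last_basis: "k \<in> mirabolic \<Longrightarrow> last_basis v* k = last_basis"
  by (simp add: last_basis_mult mirabolic_def vec_eq_iff last_basis_nth)

text \<open>The last rows of \<open>k\<close> and of its inverse vanish off the last column, so
  omitting the last index from a product sum loses only a zero term. Hence the block of the inverse
  is the inverse of the block.\<close>

lemma mirabolicI:
  fixes k :: "'a::nonarch_local_field ^ 'n::{finite,linorder} ^ 'n::{finite,linorder}"
  assumes "k \<in> GLO" "last_basis v* k = last_basis"
  shows "k \<in> mirabolic"
proof -
  let ?l = "matrix_inv k"
  have l: "last_basis v* ?l = last_basis"
    using GLO_vec_cancel(1)[OF assms(1), of last_basis] by (simp add: assms)
  have last: "A $ last_index $ j = 0" if "last_basis v* A = last_basis" "j \<noteq> last_index"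
    for A :: "(('a, 'n) vec, 'n) vec" and j
    using that by (auto simp: last_basis_mult vec_eq_iff last_basis_nth)
  have *: "(\<Sum>s\<in>UNIV - {last_index}. A $ i $ s * B $ s $ j) = (A ** B) $ i $ j"
    if "last_basis v* B = last_basis" "j \<noteq> last_index" for A B :: "(('a, 'n) vec, 'n) vec" and i j
    using last[OF that] unfolding matrix_matrix_mult_def
    by (simp add: sum_diff1)
  have int: "k \<in> int_mats" "?l \<in> int_mats"
    using assms(1) by (auto simp: GLO_int_mats)
  have "upper_left_block_GLO k"
    unfolding upper_left_block_GLO_def
  proof (intro conjI bexI[of _ ?l] allI impI)
    fix i j :: 'n assume ij: "i \<noteq> last_index \<and> j \<noteq> last_index"
    show "k $ i $ j \<in> int_ring"
      using int by (simp add: int_mats_def)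
    show "(\<Sum>s\<in>UNIV - {last_index}. k $ i $ s * ?l $ s $ j) = (if i = j then 1 else 0)"
      "(\<Sum>s\<in>UNIV - {last_index}. ?l $ i $ s * k $ s $ j) = (if i = j then 1 else 0)"
      using ij assms(1) by (simp_all add: *[OF l] *[OF assms(2)], simp_all add: mat_def)
  qed (fact int)
  then show ?thesis
    using assms int by (auto simp: mirabolic_def int_mats_def last_basis_mult last_basis_nth)
qed

section \<open>Moving vectors by matrices that differ from the identity in one row\<close>

definition row_mat :: "'n \<Rightarrow> 'a::nonarch_local_field ^ 'n \<Rightarrow> 'a ^ 'n ^ 'n" where
  "row_mat r w = (\<chi> i. if i = r then w else axis i 1)"

lemma vec_row_mat: "(x v* row_mat r w) $ j = x $ j + x $ r * (w $ j - axis r 1 $ j)"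
proof -
  have "(x v* row_mat r w) $ j = (\<Sum>i\<in>UNIV. x $ i * axis i 1 $ j + (if i = r then x $ r * (w $ j - axis r 1 $ j) else 0))"
    unfolding vector_matrix_mult_def row_mat_def by (auto intro!: sum.cong simp: algebra_simps)
  also have "\<dots> = (\<Sum>i\<in>UNIV. if i = j then x $ j else 0) + x $ r * (w $ j - axis r 1 $ j)"
    unfolding sum.distrib by (intro arg_cong2[of _ _ _ _ "(+)"] sum.cong) (auto simp: axis_def)
  also have "\<dots> = x $ j + x $ r * (w $ j - axis r 1 $ j)"
    by simp
  finally show ?thesis .
qed

lemma row_mat_GLO:
  fixes w :: "'a::nonarch_local_field ^ 'n"
  assumes "\<And>i. absv (w $ i) \<le> 1" "absv (w $ r) = 1"
  shows "row_mat r w \<in> GLO"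
proof (rule GLO_I)
  \<comment> \<open>Row \<open>r\<close> of the inverse, found by solving
    \<open>w v* row_mat r ?w = axis r 1\<close> with \<open>vec_row_mat\<close>.\<close>
  let ?w = "\<chi> i. if i = r then inverse (w $ r) else - w $ i / w $ r"
  have nz: "w $ r \<noteq> 0"
    using assms(2) by auto
  show "row_mat r w \<in> int_mats" "row_mat r ?w \<in> int_mats"
    using assms by (auto simp: int_mats_iff row_mat_def axis_def)
  have "(A ** B) $ i = A $ i v* B" for A B :: "'a ^ 'n ^ 'n" and i
    by (simp add: vec_eq_iff matrix_matrix_mult_def vector_matrix_mult_def)
  then show "row_mat r w ** row_mat r ?w = mat 1"
    using nz by (auto simp: vec_eq_iff vec_row_mat) (auto simp: row_mat_def mat_def axis_def field_simps)
qed

text \<open>The displacement \<open>y - x\<close> is divided by the pivot \<open>x $ r\<close> and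
  added to row \<open>r\<close> of the identity; the bound \<open>diff\<close> makes the result
  integral. Only row \<open>r\<close> changes, so for \<open>r \<noteq> last_index\<close> the
  vector \<open>last_basis\<close> stays fixed. One matrix serves every \<open>m\<close>, which is
  why \<open>m\<close> is quantified inside the last conclusion.\<close>

lemma move_vec:
  fixes x y :: "'a::nonarch_local_field ^ 'n::{finite,linorder}"
  assumes "x $ r \<noteq> 0" "absv (y $ r) = absv (x $ r)"
    and diff: "\<And>i. absv (y $ i - x $ i) \<le> absv (x $ r)"
  obtains k where "k \<in> GLO" "y = x v* k" "r \<noteq> last_index \<Longrightarrow> k \<in> mirabolic"
    "\<And>m. (\<And>i. absv (y $ i - x $ i) \<le> absv (unif::'a) ^ m * absv (x $ r)) \<Longrightarrow> k \<in> congruence_subgroup m"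
proof
  let ?w = "\<chi> i. axis r 1 $ i + (y $ i - x $ i) / x $ r"
  let ?k = "row_mat r ?w"
  have d: "absv ((y $ i - x $ i) / x $ r) \<le> 1" for i
    using diff[of i] assms(1) by (simp add: divide_le_eq_1 less_le)
  have wr: "?w $ r = y $ r / x $ r"
    using assms(1) by (simp add: axis_def field_simps)
  show k: "?k \<in> GLO"
  proof (rule row_mat_GLO)
    show "absv (?w $ i) \<le> 1" for i
      using d[of i] unfolding vec_lambda_beta by (intro absv_add_le) (auto simp: axis_def)
    show "absv (?w $ r) = 1"
      unfolding wr using assms by simp
  qed
  show "y = x v* ?k"
    using assms(1) by (simp add: vec_eq_iff vec_row_mat)
  show "?k \<in> mirabolic" if "r \<noteq> last_index"
    using k that by (intro mirabolicI) (auto simp: vec_eq_iff vec_row_mat last_basis_nth)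
  show "?k \<in> congruence_subgroup m" if "\<And>i. absv (y $ i - x $ i) \<le> absv (unif::'a) ^ m * absv (x $ r)" for m
  proof -
    have "absv (y $ i - x $ i) / absv (x $ r) \<le> absv (unif::'a) ^ m" for i
      using that[of i] assms(1) by (subst pos_divide_le_eq) (auto simp: less_le)
    then have "mat_cong m ?k (mat 1)"
      by (auto simp: mat_cong_def row_mat_def mat_def axis_def)
    then show ?thesis
      using k by (simp add: congruence_subgroup_iff)
  qed
qed

lemma move_vec2:
  fixes x y :: "'a::nonarch_local_field ^ 'n::{finite,linorder}"
  assumes "x $ p \<noteq> 0" "absv (y $ r) = absv (x $ p)" "absv (x $ r) \<le> absv (x $ p)"
    and diff: "\<And>i. absv (y $ i - x $ i) \<le> absv (x $ p)"
  obtains k l where "k \<in> GLO" "l \<in> GLO" "y = x v* k v* l"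
    "p \<noteq> last_index \<Longrightarrow> k \<in> mirabolic" "r \<noteq> last_index \<Longrightarrow> l \<in> mirabolic"
proof -
  \<comment> \<open>With pivot \<open>p\<close>, coordinate \<open>r\<close> is first given its
    final value; it is then as large as the old pivot and can serve as pivot for the remaining
    coordinates.\<close>
  define z where "z = (\<chi> i. if i = r then y $ r else x $ i)"
  obtain k where k: "k \<in> GLO" "z = x v* k" "p \<noteq> last_index \<Longrightarrow> k \<in> mirabolic"
    by (rule move_vec[of x p z]) (use assms in \<open>auto simp: z_def\<close>)
  obtain l where l: "l \<in> GLO" "y = z v* l" "r \<noteq> last_index \<Longrightarrow> l \<in> mirabolic"
    by (rule move_vec[of z r y]) (use assms in \<open>auto simp: z_def\<close>)
  show ?thesis
    using k l by (intro that[of k l]) auto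
qed

lemma sphere_transitive:
  fixes x :: "'a::nonarch_local_field ^ 'n::{finite,linorder}"
  assumes "x \<in> unit_sphere"
  obtains k where "k \<in> GLO" "x = last_basis v* k"
proof -
  obtain r where r: "absv (x $ r) = 1"
    using assms by (auto simp: unit_sphere_iff)
  obtain k l where "k \<in> GLO" "l \<in> GLO" "x = last_basis v* k v* l"
    by (rule move_vec2[of last_basis last_index x r])
      (use assms r in \<open>auto simp: last_basis_nth unit_sphere_iff intro!: absv_diff_le\<close>)
  then show ?thesis
    by (intro that[of "k ** l"]) (auto simp: vector_matrix_mul_assoc)
qed

section \<open>Averaging over the Haar measure\<close>

text \<open>Digit expansion: a representative to order \<open>Suc m\<close> is one to order
  \<open>m\<close> plus \<open>unif ^ m\<close> times a residue digit, and there are finitely many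
  digits.\<close>

lemma finite_residues:
  "\<exists>T. finite T \<and> (\<forall>x::'a::nonarch_local_field. absv x \<le> 1 \<longrightarrow> (\<exists>t\<in>T. absv (x - t) \<le> absv (unif::'a) ^ m))"
proof (induction m)
  case 0
  then show ?case
    by (intro exI[of _ "{0}"]) auto
next
  case (Suc m)
  then obtain T :: "'a set" where T: "finite T"
    "\<And>x. absv x \<le> 1 \<Longrightarrow> \<exists>t\<in>T. absv (x - t) \<le> absv (unif::'a) ^ m"
    by blast
  define S where "S = (\<lambda>C. SOME c. c \<in> C) ` ({x::'a. absv x \<le> 1} // residue_rel)"
  have S: "\<exists>s\<in>S. absv (x - s) \<le> absv (unif::'a)" if "absv x \<le> 1" for x
  proof -
    let ?C = "residue_rel `` {x}"
    have "x \<in> ?C"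
      using that by simp
    then have "(SOME c. c \<in> ?C) \<in> ?C"
      by (rule someI)
    moreover have "(SOME c. c \<in> ?C) \<in> S"
      unfolding S_def using that by (intro imageI quotientI) simp
    ultimately show ?thesis
      by (auto simp flip: absv_less_1_iff)
  qed
  have "finite S"
    unfolding S_def using finite_residue_field by (rule finite_imageI)
  moreover have "\<exists>r\<in>(\<lambda>(t, s). t + unif ^ m * s) ` (T \<times> S). absv (x - r) \<le> absv (unif::'a) ^ Suc m"
    if x: "absv x \<le> 1" for x
  proof -
    obtain t where t: "t \<in> T" "absv (x - t) \<le> absv (unif::'a) ^ m"
      using T(2)[OF x] by blast
    then have "absv ((x - t) / unif ^ m) \<le> 1"
      using absv_unif_pos[where 'a='a] by (simp add: divide_simps)
    then obtain s where s: "s \<in> S" "absv ((x - t) / unif ^ m - s) \<le> absv (unif::'a)"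
      using S by blast
    have "x - (t + unif ^ m * s) = unif ^ m * ((x - t) / unif ^ m - s)"
      by (simp add: field_simps)
    then have "absv (x - (t + unif ^ m * s)) = absv (unif::'a) ^ m * absv ((x - t) / unif ^ m - s)"
      by (simp only: absv_mult absv_power)
    also have "\<dots> \<le> absv (unif::'a) ^ m * absv (unif::'a)"
      using s(2) by (intro mult_left_mono) auto
    finally show ?thesis
      using t(1) s(1) by (auto simp: mult.commute)
  qed
  ultimately show ?case
    using T(1) by (intro exI[of _ "(\<lambda>(t, s). t + unif ^ m * s) ` (T \<times> S)"]) auto
qed

lemma finite_mats:
  assumes "finite T"
  shows "finite {A::'a ^ 'n ^ 'n. \<forall>i j. A $ i $ j \<in> T}"
proof (rule finite_subset)
  show "{A::'a ^ 'n ^ 'n. \<forall>i j. A $ i $ j \<in> T} \<subseteq> (\<lambda>f. \<chi> i j. f (i, j)) ` (UNIV \<rightarrow>\<^sub>E T)"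
  proof
    fix A :: "'a ^ 'n ^ 'n" assume "A \<in> {A. \<forall>i j. A $ i $ j \<in> T}"
    then show "A \<in> (\<lambda>f. \<chi> i j. f (i, j)) ` (UNIV \<rightarrow>\<^sub>E T)"
      by (intro image_eqI[of _ _ "\<lambda>(i, j). A $ i $ j"]) (auto simp: vec_eq_iff)
  qed
  show "finite ((\<lambda>f. \<chi> i j. f (i, j)) ` (UNIV \<rightarrow>\<^sub>E T) :: ('a ^ 'n ^ 'n) set)"
    using assms by (intro finite_imageI finite_PiE) auto
qed

text \<open>The centre may be any matrix: \<open>finite_cosets\<close> uses centres assembled entry
  by entry from residue representatives, and these need not be invertible.\<close>

definition coset :: "nat \<Rightarrow> 'a::nonarch_local_field ^ 'n ^ 'n \<Rightarrow> ('a ^ 'n ^ 'n) set" where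
  "coset m k = {k' \<in> GLO. mat_cong m k k'}"

lemma coset_eq: "mat_cong m k k' \<Longrightarrow> coset m k = coset m k'"
  using mat_cong_trans[of m k k'] mat_cong_trans[of m k' k] mat_cong_sym[of m k k']
  by (auto simp: coset_def)

lemma finite_cosets: "finite (coset m ` (GLO :: ('a::nonarch_local_field ^ 'n ^ 'n) set))"
proof -
  obtain T :: "'a set" where T: "finite T"
    "\<And>x. absv x \<le> 1 \<Longrightarrow> \<exists>t\<in>T. absv (x - t) \<le> absv (unif::'a) ^ m"
    using finite_residues by blast
  have "coset m k \<in> coset m ` {A. \<forall>i j. A $ i $ j \<in> T}" if "k \<in> GLO" for k :: "'a ^ 'n ^ 'n"
  proof -
    have "\<exists>t\<in>T. absv (k $ i $ j - t) \<le> absv (unif::'a) ^ m" for i j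
      using T(2) GLO_int_mats[OF that] by (simp add: int_mats_iff)
    then obtain f where f: "\<And>i j. f i j \<in> T" "\<And>i j. absv (k $ i $ j - f i j) \<le> absv (unif::'a) ^ m"
      by metis
    let ?A = "\<chi> i j. f i j"
    have "mat_cong m k ?A"
      using f by (simp add: mat_cong_def)
    then have "coset m k = coset m ?A"
      by (rule coset_eq)
    then show ?thesis
      using f(1) by (intro image_eqI[of _ _ ?A]) auto
  qed
  then have "coset m ` (GLO :: ('a ^ 'n ^ 'n) set) \<subseteq> coset m ` {A. \<forall>i j. A $ i $ j \<in> T}"
    by blast
  then show ?thesis
    by (rule finite_subset) (intro finite_imageI finite_mats T)
qed

lemma coset_borel:
  "coset m k \<in> sets (restrict_space borel (GLO :: ('a::nonarch_local_field ^ 'n ^ 'n) set))"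
proof -
  \<comment> \<open>The radius \<open>absv unif ^ m / absv unif\<close> is the next larger value of
    \<open>absv\<close>. By discreteness the open ball of this radius is the closed ball of radius
    \<open>absv unif ^ m\<close>, so the class is relatively open.\<close>
  let ?U = "\<lambda>i j. {k'. dist (k $ i $ j) (k' $ i $ j) < absv (unif::'a) ^ m / absv (unif::'a)}"
  have less: "absv x \<le> absv (unif::'a) ^ m \<longleftrightarrow> absv x < absv (unif::'a) ^ m / absv (unif::'a)" for x :: 'a
  proof
    assume "absv x \<le> absv (unif::'a) ^ m"
    also have "\<dots> < absv (unif::'a) ^ m / absv (unif::'a)"
      using absv_unif_pos[where 'a='a] absv_unif_less_1[where 'a='a] by (simp add: divide_simps)
    finally show "absv x < absv (unif::'a) ^ m / absv (unif::'a)" .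
  next
    assume "absv x < absv (unif::'a) ^ m / absv (unif::'a)"
    then have "absv (unif * x / unif ^ m) < 1"
      using absv_unif_pos[where 'a='a] by (simp add: absv_mult divide_simps mult.commute)
    then have "absv (unif * x / unif ^ m) \<le> absv (unif::'a)"
      unfolding absv_less_1_iff .
    then show "absv x \<le> absv (unif::'a) ^ m"
      using absv_unif_pos[where 'a='a] by (simp add: absv_mult divide_simps)
  qed
  have "open (?U i j)" for i j
    by (intro open_Collect_less continuous_intros)
  then have "open (\<Inter>i. \<Inter>j. ?U i j)"
    by (intro open_INT) auto
  moreover have "coset m k = GLO \<inter> (\<Inter>i. \<Inter>j. ?U i j)"
    by (auto simp: coset_def mat_cong_def dist_absv less)
  ultimately show ?thesis
    by (auto simp: sets_restrict_space)
qed

text \<open>Together with left invariance this gives all congruence classes the same Haar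
  measure.\<close>

lemma left_mult_coset:
  assumes "r \<in> GLO" "r' \<in> GLO"
  shows "(\<lambda>k. (r' ** matrix_inv r) ** k) ` coset m r = coset m r'"
proof -
  define g where "g = r' ** matrix_inv r"
  have g: "g \<in> GLO" "g ** r = r'"
    using assms by (auto simp: g_def)
  have "k \<in> (\<lambda>k. g ** k) ` coset m r" if "k \<in> coset m r'" for k
  proof (rule image_eqI[of _ _ "matrix_inv g ** k"])
    have "mat_cong m (g ** r) (g ** (matrix_inv g ** k))"
      using that g by (simp add: coset_def)
    then show "matrix_inv g ** k \<in> coset m r"
      using that g by (subst (asm) mat_cong_cancel_left) (auto simp: coset_def)
  qed (use g in simp)
  moreover have "g ** k \<in> coset m r'" if "k \<in> coset m r" for k
    using that g by (auto simp: coset_def mat_cong_cancel_left simp flip: g(2))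
  ultimately show ?thesis
    unfolding g_def by blast
qed

text \<open>Finitely many classes of equal measure make up a probability space, so a function
  constant on classes integrates to its mean over a transversal \<open>R\<close>. The transversal is
  chosen before the integrand, so one \<open>R\<close> serves several integrals.\<close>

lemma haar_average:
  fixes M :: "('a::nonarch_local_field ^ 'n ^ 'n) measure"
  assumes "haar_prob M"
  obtains R where "finite R" "R \<subseteq> GLO" "R \<noteq> {}" "\<And>k. k \<in> GLO \<Longrightarrow> \<exists>!r. r \<in> R \<and> mat_cong m k r"
    "\<And>F::_ \<Rightarrow> complex. (\<And>k k'. k \<in> GLO \<Longrightarrow> k' \<in> GLO \<Longrightarrow> mat_cong m k k' \<Longrightarrow> F k = F k')
       \<Longrightarrow> (LINT k|M. F k) = (\<Sum>r\<in>R. F r) / of_nat (card R)"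
proof -
  interpret prob_space M
    using assms by (simp add: haar_prob_def)
  have sets: "sets M = sets (restrict_space borel GLO)"
    and invar: "\<And>g A. g \<in> GLO \<Longrightarrow> A \<in> sets M \<Longrightarrow> emeasure M ((\<lambda>k. g ** k) ` A) = emeasure M A"
    using assms by (auto simp: haar_prob_def)
  have space: "space M = GLO"
    using sets_eq_imp_space_eq[OF sets] by (simp add: space_restrict_space)
  have coset_M: "coset m k \<in> sets M" for k
    unfolding sets by (rule coset_borel)
  define s where "s C = (SOME k. k \<in> C)" for C :: "('a ^ 'n ^ 'n) set"
  have s: "s (coset m k) \<in> GLO" "mat_cong m k (s (coset m k))" if "k \<in> GLO" for k
    using someI[of "\<lambda>k'. k' \<in> coset m k" k] that by (auto simp: coset_def s_def)
  define R where "R = s ` coset m ` GLO"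
  have R: "finite R" "R \<subseteq> GLO"
    using finite_cosets s by (auto simp: R_def)
  have repr: "s (coset m k) \<in> R" if "k \<in> GLO" for k
    using that by (auto simp: R_def)
  have uniq: "r = s (coset m k)" if "r \<in> R" "mat_cong m k r" for k r
  proof -
    obtain k' where k': "k' \<in> GLO" "r = s (coset m k')"
      using \<open>r \<in> R\<close> by (auto simp: R_def)
    have "mat_cong m k k'"
      using mat_cong_trans[OF \<open>mat_cong m k r\<close> mat_cong_sym[OF s(2)[OF k'(1), folded k'(2)]]] .
    then show ?thesis
      by (simp add: k'(2) coset_eq)
  qed
  define c where "c = measure M (coset m (mat 1))"
  have c: "measure M (coset m r) = c" if "r \<in> GLO" for r
    using invar[OF _ coset_M, of "r ** matrix_inv (mat 1)" "mat 1"] that left_mult_coset[of "mat 1" r m]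
    by (simp add: c_def measure_def)
  have LINT: "(LINT k|M. F k) = of_real c * (\<Sum>r\<in>R. F r)"
    if F: "\<And>k k'. k \<in> GLO \<Longrightarrow> k' \<in> GLO \<Longrightarrow> mat_cong m k k' \<Longrightarrow> F k = F k'" for F :: "_ \<Rightarrow> complex"
  proof -
    have "F k = (\<Sum>r\<in>R. indicat_real (coset m r) k *\<^sub>R F r)" if k: "k \<in> GLO" for k
    proof -
      define r where "r = s (coset m k)"
      have r: "r \<in> R" "mat_cong m k r"
        using k repr s by (auto simp: r_def)
      have "indicat_real (coset m r') k *\<^sub>R F r' = (if r' = r then F r else 0)" if "r' \<in> R" for r'
      proof (cases "k \<in> coset m r'")
        case True
        then have "r' = r"
          using uniq[OF that, of k] by (simp add: coset_def r_def mat_cong_sym)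
        with True show ?thesis
          by simp
      next
        case False
        then have "r' \<noteq> r"
          using k mat_cong_sym[OF r(2)] by (auto simp: coset_def)
        with False show ?thesis
          by simp
      qed
      then have "(\<Sum>r'\<in>R. indicat_real (coset m r') k *\<^sub>R F r') = (\<Sum>r'\<in>R. if r' = r then F r else 0)"
        by (intro sum.cong) auto
      also have "\<dots> = F r"
        using R r(1) by simp
      also have "\<dots> = F k"
        using F[OF k _ r(2)] R r(1) by auto
      finally show ?thesis ..
    qed
    then have "(LINT k|M. F k) = (LINT k|M. (\<Sum>r\<in>R. indicat_real (coset m r) k *\<^sub>R F r))"
      by (intro Bochner_Integration.integral_cong) (auto simp: space)
    also have "\<dots> = (\<Sum>r\<in>R. LINT k|M. indicat_real (coset m r) k *\<^sub>R F r)"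
      by (intro Bochner_Integration.integral_sum integrable_scaleR_left)
        (auto simp: coset_M integrable_real_indicator less_top[symmetric])
    also have "\<dots> = (\<Sum>r\<in>R. measure M (coset m r) *\<^sub>R F r)"
    proof (intro sum.cong refl)
      fix r
      have "(LINT k|M. indicat_real (coset m r) k *\<^sub>R F r) = (LINT k|M. indicat_real (coset m r) k) *\<^sub>R F r"
        by (rule integral_scaleR_left)
          (auto simp: coset_M integrable_real_indicator less_top[symmetric])
      then show "(LINT k|M. indicat_real (coset m r) k *\<^sub>R F r) = measure M (coset m r) *\<^sub>R F r"
        using sets.sets_into_space[OF coset_M[of r]] by (simp add: Int_absorb2)
    qed
    also have "\<dots> = (\<Sum>r\<in>R. of_real c * F r)"
      using R c by (intro sum.cong) (auto simp: scaleR_conv_of_real)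
    finally show ?thesis
      by (simp add: sum_distrib_left)
  qed
  \<comment> \<open>The constant function 1 both identifies \<open>c\<close> and rules out
    \<open>card R = 0\<close>.\<close>
  have "1 = complex_of_real c * of_nat (card R)"
    using LINT[of "\<lambda>_. 1"] by (simp add: prob_space)
  moreover from this have card: "card R \<noteq> 0"
    by (intro notI) simp
  ultimately have "complex_of_real c = 1 / of_nat (card R)"
    by (simp add: field_simps)
  then have avg: "(LINT k|M. F k) = (\<Sum>r\<in>R. F r) / of_nat (card R)"
    if "\<And>k k'. k \<in> GLO \<Longrightarrow> k' \<in> GLO \<Longrightarrow> mat_cong m k k' \<Longrightarrow> F k = F k'" for F :: "_ \<Rightarrow> complex"
    using LINT[OF that] by simp
  have ex: "\<exists>!r. r \<in> R \<and> mat_cong m k r" if "k \<in> GLO" for k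
  proof (rule ex1I[of _ "s (coset m k)"])
    show "s (coset m k) \<in> R \<and> mat_cong m k (s (coset m k))"
      using repr[OF that] s(2)[OF that] ..
    show "r = s (coset m k)" if "r \<in> R \<and> mat_cong m k r" for r
      using that uniq by simp
  qed
  have "R \<noteq> {}"
    using card by auto
  then show ?thesis
    by (rule that[OF R _ ex avg])
qed

section \<open>Hermitian forms on finite-dimensional function spaces\<close>

interpretation cfun: vector_space cscale
  by (rule vector_space_cscale)

lemma cscale_apply: "cscale c f x = c * f x"
  by (simp add: cscale_def)

lemma sum_fun_apply: "(\<Sum>i\<in>I. f i) x = (\<Sum>i\<in>I. f i x :: 'c::comm_monoid_add)"
  by (induction I rule: infinite_finite_induct) (auto simp: zero_fun_def)

text \<open>The axioms are relative to \<open>V\<close> because \<open>sphere_inner\<close> is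
  definite only on functions that vanish off the sphere, and is a finite mean only on
  congruence-invariant ones. \<open>finite_span\<close> allows a finite span larger than
  \<open>V\<close>, a condition that subspaces inherit.\<close>

locale hermitian_form =
  fixes V :: "('b \<Rightarrow> complex) set" and ip :: "('b \<Rightarrow> complex) \<Rightarrow> ('b \<Rightarrow> complex) \<Rightarrow> complex"
  assumes subspace: "cfun.subspace V"
    and finite_span: "\<exists>B. finite B \<and> V \<subseteq> cfun.span B"
    and ip_add: "f \<in> V \<Longrightarrow> g \<in> V \<Longrightarrow> h \<in> V \<Longrightarrow> ip (f + g) h = ip f h + ip g h"
    and ip_scale: "f \<in> V \<Longrightarrow> h \<in> V \<Longrightarrow> ip (cscale c f) h = c * ip f h"
    and ip_cnj: "f \<in> V \<Longrightarrow> g \<in> V \<Longrightarrow> ip g f = cnj (ip f g)"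
    and ip_nonneg: "f \<in> V \<Longrightarrow> 0 \<le> Re (ip f f)"
    and ip_definite: "f \<in> V \<Longrightarrow> ip f f = 0 \<Longrightarrow> f = 0"
begin

lemma mem_0: "0 \<in> V" and mem_add: "f \<in> V \<Longrightarrow> g \<in> V \<Longrightarrow> f + g \<in> V"
  and mem_scale: "f \<in> V \<Longrightarrow> cscale c f \<in> V" and mem_diff: "f \<in> V \<Longrightarrow> g \<in> V \<Longrightarrow> f - g \<in> V"
  and mem_sum: "(\<And>i. i \<in> I \<Longrightarrow> F i \<in> V) \<Longrightarrow> sum F I \<in> V"
  using subspace
  by (auto intro: cfun.subspace_0 cfun.subspace_add cfun.subspace_scale cfun.subspace_diff cfun.subspace_sum)

lemma subform:
  assumes "cfun.subspace W" "W \<subseteq> V"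
  shows "hermitian_form W ip"
proof
  show "cfun.subspace W"
    by fact
  show "\<exists>B. finite B \<and> W \<subseteq> cfun.span B"
    using finite_span assms(2) by (meson subset_trans)
  fix f g h :: "'b \<Rightarrow> complex" and c
  assume f: "f \<in> W"
  then have "f \<in> V"
    using assms(2) by blast
  then show "0 \<le> Re (ip f f)" "ip f f = 0 \<Longrightarrow> f = 0"
    by (simp_all add: ip_nonneg ip_definite)
  show "ip (cscale c f) h = c * ip f h" if "h \<in> W"
    using \<open>f \<in> V\<close> assms(2) that by (intro ip_scale) auto
  assume "g \<in> W"
  then have "g \<in> V"
    using assms(2) by blast
  then show "ip g f = cnj (ip f g)"
    using \<open>f \<in> V\<close> by (intro ip_cnj)
  show "ip (f + g) h = ip f h + ip g h" if "h \<in> W"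
    using \<open>f \<in> V\<close> \<open>g \<in> V\<close> assms(2) that by (intro ip_add) auto
qed

lemma ip_diff: "f \<in> V \<Longrightarrow> g \<in> V \<Longrightarrow> h \<in> V \<Longrightarrow> ip (f - g) h = ip f h - ip g h"
  using ip_add[of "f - g" g h] mem_diff[of f g] by (simp add: diff_add_cancel)

lemma ip_zero: "h \<in> V \<Longrightarrow> ip 0 h = 0"
  using ip_diff[of h h h] by simp

lemma ip_zero_right: "h \<in> V \<Longrightarrow> ip h 0 = 0"
  using ip_cnj[of 0 h] ip_zero mem_0 by simp

lemma ip_sum:
  "(\<And>i. i \<in> I \<Longrightarrow> F i \<in> V) \<Longrightarrow> h \<in> V \<Longrightarrow> ip (sum F I) h = (\<Sum>i\<in>I. ip (F i) h)"
  by (induction I rule: infinite_finite_induct) (auto simp: ip_zero ip_add mem_sum)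

lemma ip_add_right: "f \<in> V \<Longrightarrow> g \<in> V \<Longrightarrow> h \<in> V \<Longrightarrow> ip h (f + g) = ip h f + ip h g"
  using ip_add[of f g h] ip_cnj[of "f + g" h] ip_cnj[of f h] ip_cnj[of g h] mem_add by simp

lemma ip_diff_right: "f \<in> V \<Longrightarrow> g \<in> V \<Longrightarrow> h \<in> V \<Longrightarrow> ip h (f - g) = ip h f - ip h g"
  using ip_diff[of f g h] ip_cnj[of "f - g" h] ip_cnj[of f h] ip_cnj[of g h] mem_diff by simp

lemma ip_scale_right: "f \<in> V \<Longrightarrow> h \<in> V \<Longrightarrow> ip h (cscale c f) = cnj c * ip h f"
  using ip_scale[of f h c] ip_cnj[of "cscale c f" h] ip_cnj[of f h] mem_scale by simp

lemma ip_sum_right: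
  "(\<And>i. i \<in> I \<Longrightarrow> F i \<in> V) \<Longrightarrow> h \<in> V \<Longrightarrow> ip h (sum F I) = (\<Sum>i\<in>I. ip h (F i))"
  by (induction I rule: infinite_finite_induct) (auto simp: ip_zero_right ip_add_right mem_sum)

section \<open>Orthogonal projection and Gram-Schmidt\<close>

definition orthonormal :: "('b \<Rightarrow> complex) set \<Rightarrow> bool" where
  "orthonormal C \<longleftrightarrow> finite C \<and> C \<subseteq> V \<and> (\<forall>c\<in>C. \<forall>d\<in>C. ip c d = (if c = d then 1 else 0))"

definition proj :: "('b \<Rightarrow> complex) set \<Rightarrow> ('b \<Rightarrow> complex) \<Rightarrow> 'b \<Rightarrow> complex" where
  "proj C f = (\<Sum>c\<in>C. cscale (ip f c) c)"

lemma proj_in_span: "proj C f \<in> cfun.span C"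
  unfolding proj_def by (intro cfun.span_sum cfun.span_scale cfun.span_base)

lemma proj_in_V: "orthonormal C \<Longrightarrow> proj C f \<in> V"
  unfolding proj_def orthonormal_def by (intro mem_sum mem_scale) auto

lemma ip_proj:
  assumes "orthonormal C" "f \<in> V" "d \<in> C"
  shows "ip (proj C f) d = ip f d"
proof -
  have "ip (proj C f) d = (\<Sum>c\<in>C. ip (cscale (ip f c) c) d)"
    unfolding proj_def using assms by (intro ip_sum) (auto simp: orthonormal_def intro: mem_scale)
  also have "\<dots> = (\<Sum>c\<in>C. if c = d then ip f d else 0)"
    using assms by (intro sum.cong refl, subst ip_scale) (auto simp: orthonormal_def)
  also have "\<dots> = ip f d"
    using assms by (simp add: orthonormal_def)
  finally show ?thesis .
qed

lemma ip_eq_zero_span: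
  assumes "C \<subseteq> V" "f \<in> V" "\<And>c. c \<in> C \<Longrightarrow> ip f c = 0" "g \<in> cfun.span C"
  shows "ip f g = 0"
proof -
  have "g \<in> V \<and> ip f g = 0"
    using assms(4)
  proof (induction rule: cfun.span_induct_alt)
    case (step c x y)
    then have "x \<in> V" "y \<in> V"
      using assms(1) by auto
    then have "ip f (cscale c x + y) = cnj c * ip f x + ip f y"
      using assms(2) by (subst ip_add_right) (simp_all only: ip_scale_right mem_scale)
    also have "\<dots> = 0"
      using step assms(3) by simp
    finally show ?case
      using mem_add[OF mem_scale[OF \<open>x \<in> V\<close>] \<open>y \<in> V\<close>] by (rule conjI[rotated])
  qed (use mem_0 ip_zero_right[OF assms(2)] in \<open>simp add: zero_fun_def\<close>)
  then show ?thesis ..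
qed

lemma ip_diff_proj:
  assumes "orthonormal C" "f \<in> V" "g \<in> cfun.span C"
  shows "ip (f - proj C f) g = 0"
proof (rule ip_eq_zero_span[OF _ _ _ assms(3)])
  show "C \<subseteq> V" and "f - proj C f \<in> V"
    using assms mem_diff[OF assms(2) proj_in_V[OF assms(1)]] by (simp_all add: orthonormal_def)
  fix c assume "c \<in> C"
  then have "c \<in> V"
    using \<open>C \<subseteq> V\<close> by blast
  then show "ip (f - proj C f) c = 0"
    using ip_diff[OF assms(2) proj_in_V[OF assms(1)]] ip_proj[OF assms(1,2) \<open>c \<in> C\<close>] by simp
qed

text \<open>The residual \<open>f - proj C f\<close> lies in the span and is orthogonal to it, hence
  to itself.\<close>

lemma proj_eq:
  assumes "orthonormal C" "f \<in> V" "f \<in> cfun.span C"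
  shows "proj C f = f"
proof -
  have "ip (f - proj C f) (f - proj C f) = 0"
    using assms by (intro ip_diff_proj cfun.span_diff proj_in_span)
  then show ?thesis
    using ip_definite[of "f - proj C f"] assms by (simp add: mem_diff proj_in_V)
qed

text \<open>One Gram-Schmidt step. A vector already in the span is dropped, since its residual would
  be zero and could not be normalised.\<close>

lemma orthonormal_extend:
  assumes "orthonormal C" "b \<in> V"
  shows "\<exists>C'. orthonormal C' \<and> cfun.span C' = cfun.span (insert b C)"
proof (cases "b \<in> cfun.span C")
  case True
  then show ?thesis
    using assms cfun.span_redundant by blast
next
  case False
  define p where "p = b - proj C b"
  have p: "p \<in> V" "ip p g = 0" if "g \<in> cfun.span C" for g
    using assms that by (auto simp: p_def mem_diff proj_in_V ip_diff_proj)
  have pV: "p \<in> V"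
    using p(1)[OF cfun.span_zero] .
  have "p \<noteq> 0"
    using False proj_in_span[of C b] by (auto simp: p_def)
  \<comment> \<open>Hermitian symmetry makes \<open>ip p p\<close> real, so \<open>t\<close> loses
    nothing and its square root can normalise \<open>p\<close>.\<close>
  define t where "t = Re (ip p p)"
  have t: "ip p p = of_real t"
    using ip_cnj[OF pV pV] by (auto simp: t_def complex_eq_iff)
  have "t \<noteq> 0"
    using ip_definite[OF pV] \<open>p \<noteq> 0\<close> t by auto
  moreover have "t \<ge> 0"
    using ip_nonneg[OF pV] by (simp add: t_def)
  ultimately have "t > 0"
    by simp
  define q where "q = cscale (of_real (1 / sqrt t)) p"
  have q: "q \<in> V"
    using pV by (simp add: q_def mem_scale)
  have "ip q q = of_real (1 / sqrt t) * of_real (1 / sqrt t) * of_real t"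
    using pV by (simp add: q_def ip_scale ip_scale_right mem_scale t)
  also have "\<dots> = of_real (1 / sqrt t * (1 / sqrt t) * t)"
    by (simp only: of_real_mult)
  also have "1 / sqrt t * (1 / sqrt t) * t = 1"
    using \<open>t > 0\<close> by simp
  finally have qq: "ip q q = 1"
    by simp
  have qc: "ip q c = 0" "ip c q = 0" if "c \<in> C" for c
  proof -
    have c: "c \<in> V"
      using assms that by (auto simp: orthonormal_def)
    show "ip q c = 0"
      using p(2)[OF cfun.span_base[OF that]] pV c by (simp add: q_def ip_scale)
    then show "ip c q = 0"
      using ip_cnj[OF q c] by simp
  qed
  have "orthonormal (insert q C)"
    using assms(1) q qq qc by (auto simp: orthonormal_def)
  moreover have "cfun.span (insert q C) = cfun.span (insert b C)"
    unfolding cfun.span_eq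
  proof (intro conjI insert_subsetI)
    have pr: "proj C b \<in> cfun.span (insert x C)" for x
      using proj_in_span cfun.span_mono[of C "insert x C"] by blast
    show "q \<in> cfun.span (insert b C)"
      unfolding q_def p_def by (intro cfun.span_scale cfun.span_diff pr cfun.span_base) simp
    have "b = cscale (of_real (sqrt t)) q + proj C b"
      using \<open>t > 0\<close> by (auto simp: fun_eq_iff q_def p_def cscale_apply)
    also have "\<dots> \<in> cfun.span (insert q C)"
      by (intro cfun.span_add cfun.span_scale pr cfun.span_base) simp
    finally show "b \<in> cfun.span (insert q C)" .
  qed (auto intro: cfun.span_base)
  ultimately show ?thesis
    by blast
qed

lemma orthonormal_independent:
  assumes "orthonormal C"
  shows "cfun.independent C"
  unfolding cfun.independent_explicit_finite_subsets
proof (intro allI impI ballI)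
  fix S u d
  assume S: "S \<subseteq> C" "finite S" "(\<Sum>v\<in>S. cscale (u v) v) = 0" "d \<in> S"
  have "0 = ip (\<Sum>v\<in>S. cscale (u v) v) d"
    using S assms by (auto simp: ip_zero orthonormal_def)
  also have "\<dots> = (\<Sum>v\<in>S. ip (cscale (u v) v) d)"
    using S assms by (intro ip_sum) (auto simp: orthonormal_def intro!: mem_scale)
  also have "\<dots> = (\<Sum>v\<in>S. if v = d then u d else 0)"
    using S assms by (intro sum.cong refl, subst ip_scale) (auto simp: orthonormal_def subset_iff)
  also have "\<dots> = u d"
    using S by simp
  finally show "u d = 0" ..
qed

lemma orthonormal_basis:
  obtains C where "orthonormal C" "cfun.span C = V" "card C = cdim V"
proof -
  obtain B where B: "B \<subseteq> V" "cfun.independent B" "V \<subseteq> cfun.span B"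
    "card B = cdim V"
    by (rule cfun.basis_exists)
  obtain S where S: "finite S" "V \<subseteq> cfun.span S"
    using finite_span by blast
  have "finite B"
    using cfun.independent_span_bound[OF S(1) B(2) subset_trans[OF B(1) S(2)]] by (rule conjunct1)
  then have "\<exists>C. orthonormal C \<and> cfun.span C = cfun.span B"
    using B(1)
  proof (induction B rule: finite_induct)
    case empty
    then show ?case
      by (intro exI[of _ "{}"]) (auto simp: orthonormal_def)
  next
    case (insert b B)
    obtain C where C: "orthonormal C" "cfun.span C = cfun.span B"
      using insert.IH insert.prems by (meson insert_subset)
    then obtain C' where "orthonormal C'" "cfun.span C' = cfun.span (insert b C)"
      using orthonormal_extend[OF C(1)] insert.prems by (meson insert_subset)
    moreover have "cfun.span (insert b C) = cfun.span (insert b B)"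
      using C(2) by (simp add: cfun.span_insert)
    ultimately show ?case
      by blast
  qed
  then obtain C where C: "orthonormal C" "cfun.span C = cfun.span B"
    by blast
  have span: "cfun.span C = V"
    using cfun.span_subspace[OF B(1,3) subspace] C(2) by simp
  have "card C = cdim V"
    using cfun.dim_span_eq_card_independent[OF orthonormal_independent[OF C(1)]] span by simp
  with C(1) span show ?thesis
    by (rule that)
qed

end

section \<open>Functions invariant under a congruence subgroup\<close>

lemma haar_space: "haar_prob M \<Longrightarrow> space M = GLO"
  unfolding haar_prob_def using sets_eq_imp_space_eq[of M "restrict_space borel GLO"]
  by (simp add: space_restrict_space)

text \<open>Left invariance suffices because right translation permutes the congruence classes.\<close>

lemma haar_right_invariant:
  fixes M :: "('a::nonarch_local_field ^ 'n ^ 'n) measure" and F :: "_ \<Rightarrow> complex"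
  assumes "haar_prob M" "g \<in> GLO"
    and F: "\<And>k k'. k \<in> GLO \<Longrightarrow> k' \<in> GLO \<Longrightarrow> mat_cong m k k' \<Longrightarrow> F k = F k'"
  shows "(LINT k|M. F (k ** g)) = (LINT k|M. F k)"
proof -
  obtain R where R: "finite R" "R \<subseteq> GLO"
    and ex1: "\<And>k. k \<in> GLO \<Longrightarrow> \<exists>!r. r \<in> R \<and> mat_cong m k r"
    and avg: "\<And>F::_ \<Rightarrow> complex. (\<And>k k'. k \<in> GLO \<Longrightarrow> k' \<in> GLO \<Longrightarrow> mat_cong m k k' \<Longrightarrow> F k = F k')
       \<Longrightarrow> (LINT k|M. F k) = (\<Sum>r\<in>R. F r) / of_nat (card R)"
    by (rule haar_average[OF assms(1), where m=m]) blast
  define \<rho> where "\<rho> r = (THE r'. r' \<in> R \<and> mat_cong m (r ** g) r')" for r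
  have \<rho>: "\<rho> r \<in> R" "mat_cong m (r ** g) (\<rho> r)" if "r \<in> R" for r
  proof -
    have "r ** g \<in> GLO"
      using that R(2) assms(2) by (intro GLO_mult) auto
    from theI'[OF ex1[OF this]] show "\<rho> r \<in> R" "mat_cong m (r ** g) (\<rho> r)"
      by (simp_all add: \<rho>_def)
  qed
  have "inj_on \<rho> R"
  proof (rule inj_onI)
    fix r s assume rs: "r \<in> R" "s \<in> R" "\<rho> r = \<rho> s"
    have "mat_cong m (\<rho> r) (s ** g)"
      unfolding rs(3) by (rule mat_cong_sym[OF \<rho>(2)[OF rs(2)]])
    then have "mat_cong m r s"
      using mat_cong_trans[OF \<rho>(2)[OF rs(1)]] mat_cong_cancel_right[OF assms(2)] by blast
    moreover have "r \<in> GLO"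
      using rs(1) R(2) by blast
    ultimately show "r = s"
      using ex1[of r] rs(1,2) mat_cong_refl[of m r] by metis
  qed
  moreover have "\<rho> ` R \<subseteq> R"
    using \<rho>(1) by blast
  ultimately have "bij_betw \<rho> R R"
    using endo_inj_surj[OF R(1)] by (simp add: bij_betw_def)
  then have "(\<Sum>r\<in>R. F (\<rho> r)) = (\<Sum>r\<in>R. F r)"
    by (rule sum.reindex_bij_betw)
  moreover have "F (r ** g) = F (\<rho> r)" if "r \<in> R" for r
    using that \<rho> R(2) assms(2) by (intro F GLO_mult) auto
  moreover have "(LINT k|M. F (k ** g)) = (\<Sum>r\<in>R. F (r ** g)) / of_nat (card R)"
    by (rule avg, rule F) (simp_all add: assms(2) mat_cong_cancel_right)
  moreover have "(LINT k|M. F k) = (\<Sum>r\<in>R. F r) / of_nat (card R)"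
    by (rule avg[OF F])
  ultimately show ?thesis
    by simp
qed

text \<open>Congruence invariance entails local constancy (\<open>inv_fun_smooth\<close>). No
  character is prescribed, so that the spaces of all levels up to \<open>m\<close> sit in one
  ambient space with a definite form.\<close>

definition inv_fun :: "nat \<Rightarrow> ('a::nonarch_local_field ^ 'n::{finite,linorder} \<Rightarrow> complex) set" where
  "inv_fun m = {f. (\<forall>x. x \<notin> unit_sphere \<longrightarrow> f x = 0) \<and>
     (\<forall>x\<in>unit_sphere. \<forall>k\<in>congruence_subgroup m. f (x v* k) = f x)}"

lemma inv_fun_outside: "f \<in> inv_fun m \<Longrightarrow> x \<notin> unit_sphere \<Longrightarrow> f x = 0"
  by (simp add: inv_fun_def)

lemma inv_fun_mult: "f \<in> inv_fun m \<Longrightarrow> x \<in> unit_sphere \<Longrightarrow> k \<in> congruence_subgroup m \<Longrightarrow> f (x v* k) = f x"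
  by (simp add: inv_fun_def)

lemma inv_fun_cong:
  assumes "f \<in> inv_fun m" "k \<in> GLO" "k' \<in> GLO" "mat_cong m k k'"
  shows "f (last_basis v* k) = f (last_basis v* k')"
proof -
  obtain h where h: "h \<in> congruence_subgroup m" "k' = k ** h"
    using mat_cong_imp_congruence_subgroup[OF assms(2-4)] .
  then show ?thesis
    using inv_fun_mult[OF assms(1) _ h(1), of "last_basis v* k"] assms(2)
    by (simp add: vector_matrix_mul_assoc)
qed

lemma inv_fun_mono: "m \<le> m' \<Longrightarrow> inv_fun m \<subseteq> inv_fun m'"
  using congruence_subgroup_antimono unfolding inv_fun_def by blast

lemma subspace_inv_fun: "cfun.subspace (inv_fun m)"
  unfolding cfun.subspace_def by (auto simp: inv_fun_def cscale_apply)

text \<open>Each point of the sphere is represented by one \<open>r\<close> for all functions at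
  once. Hence the values on \<open>R\<close> determine a function, which gives definiteness and
  finite dimension in \<open>hermitian_inv_fun\<close>.\<close>

lemma sphere_average:
  fixes M :: "('a::nonarch_local_field ^ 'n::{finite,linorder} ^ 'n::{finite,linorder}) measure"
  assumes "haar_prob M"
  obtains R where "finite R" "R \<noteq> {}" "R \<subseteq> GLO"
    "\<forall>x\<in>unit_sphere. \<exists>r\<in>R. \<forall>f\<in>inv_fun m. f x = f (last_basis v* r)"
    "\<forall>f\<in>inv_fun m. \<forall>g\<in>inv_fun m. sphere_inner M f g =
       (\<Sum>r\<in>R. f (last_basis v* r) * cnj (g (last_basis v* r))) / of_nat (card R)"
proof -
  obtain R where R: "finite R" "R \<subseteq> GLO" "R \<noteq> {}"
    and ex1: "\<And>k. k \<in> GLO \<Longrightarrow> \<exists>!r. r \<in> R \<and> mat_cong m k r"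
    and avg: "\<And>F::_ \<Rightarrow> complex. (\<And>k k'. k \<in> GLO \<Longrightarrow> k' \<in> GLO \<Longrightarrow> mat_cong m k k' \<Longrightarrow> F k = F k')
       \<Longrightarrow> (LINT k|M. F k) = (\<Sum>r\<in>R. F r) / of_nat (card R)"
    by (rule haar_average[OF assms, where m=m]) blast
  show ?thesis
  proof (rule that[OF R(1,3,2)]; intro ballI)
    fix x :: "('a, 'n) vec" assume "x \<in> unit_sphere"
    then obtain k where k: "k \<in> GLO" "x = last_basis v* k"
      by (rule sphere_transitive)
    then obtain r where "r \<in> R" "mat_cong m k r"
      using ex1 by blast
    then show "\<exists>r\<in>R. \<forall>f\<in>inv_fun m. f x = f (last_basis v* r)"
      using k R(2) inv_fun_cong by blast
  next
    fix f g :: "('a, 'n) vec \<Rightarrow> complex" assume fg: "f \<in> inv_fun m" "g \<in> inv_fun m"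
    show "sphere_inner M f g =
       (\<Sum>r\<in>R. f (last_basis v* r) * cnj (g (last_basis v* r))) / of_nat (card R)"
      unfolding sphere_inner_def
      by (rule avg, intro arg_cong2[of _ _ _ _ "\<lambda>a b. a * cnj b"] inv_fun_cong[OF fg(1)] inv_fun_cong[OF fg(2)])
  qed
qed

lemma hermitian_inv_fun:
  fixes M :: "('a::nonarch_local_field ^ 'n::{finite,linorder} ^ 'n::{finite,linorder}) measure"
  assumes "haar_prob M"
  shows "hermitian_form (inv_fun m) (sphere_inner M)"
proof -
  obtain R where R: "finite R" "R \<noteq> {}" "R \<subseteq> GLO"
    and R_ex: "\<forall>x\<in>unit_sphere. \<exists>r\<in>R. \<forall>f\<in>inv_fun m. f x = f (last_basis v* r)"
    and R_avg: "\<forall>f\<in>inv_fun m. \<forall>g\<in>inv_fun m. sphere_inner M f g =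
       (\<Sum>r\<in>R. f (last_basis v* r) * cnj (g (last_basis v* r))) / of_nat (card R)"
    by (rule sphere_average[OF assms, where m=m])
  note ex = bspec[OF R_ex] and avg = bspec[OF bspec[OF R_avg]]
  have card: "card R > 0"
    using R by (simp add: card_gt_0_iff)
  show ?thesis
  proof
    show "cfun.subspace (inv_fun m :: (('a, 'n) vec \<Rightarrow> complex) set)"
      by (rule subspace_inv_fun)
    obtain \<pi> where \<pi>: "\<And>x. x \<in> unit_sphere \<Longrightarrow> \<pi> x \<in> R"
      "\<And>x f. x \<in> unit_sphere \<Longrightarrow> f \<in> inv_fun m \<Longrightarrow> f x = f (last_basis v* \<pi> x)"
      using ex by metis
    \<comment> \<open>Indicators of the points assigned to \<open>r\<close>. They need not be
      congruence invariant themselves, but their span contains \<open>inv_fun m\<close>, which is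
      all that \<open>finite_span\<close> asks.\<close>
    define \<delta> :: "(('a, 'n) vec, 'n) vec \<Rightarrow> ('a, 'n) vec \<Rightarrow> complex"
      where "\<delta> r x = (if x \<in> unit_sphere \<and> \<pi> x = r then 1 else 0)" for r x
    have "f \<in> cfun.span (\<delta> ` R)" if f: "f \<in> inv_fun m" for f
    proof -
      have "f = (\<Sum>r\<in>R. cscale (f (last_basis v* r)) (\<delta> r))"
      proof
        fix x
        show "f x = (\<Sum>r\<in>R. cscale (f (last_basis v* r)) (\<delta> r)) x"
        proof (cases "x \<in> unit_sphere")
          case True
          then have "(\<Sum>r\<in>R. f (last_basis v* r) * \<delta> r x) =
              (\<Sum>r\<in>R. if r = \<pi> x then f (last_basis v* \<pi> x) else 0)"
            by (intro sum.cong) (auto simp: \<delta>_def)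
          also have "\<dots> = f x"
            using True \<pi>(1) \<pi>(2)[OF True f] R(1) by simp
          finally show ?thesis
            by (simp add: sum_fun_apply cscale_apply)
        qed (use f in \<open>simp add: sum_fun_apply cscale_apply \<delta>_def inv_fun_outside\<close>)
      qed
      also have "\<dots> \<in> cfun.span (\<delta> ` R)"
        by (intro cfun.span_sum cfun.span_scale cfun.span_base imageI)
      finally show ?thesis .
    qed
    then show "\<exists>B. finite B \<and> (inv_fun m :: (('a, 'n) vec \<Rightarrow> complex) set) \<subseteq> cfun.span B"
      using R(1) by (intro exI[of _ "\<delta> ` R"]) auto
    fix f g h :: "('a, 'n) vec \<Rightarrow> complex" and c
    assume f: "f \<in> inv_fun m"
    show "sphere_inner M (cscale c f) h = c * sphere_inner M f h" if "h \<in> inv_fun m"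
      using avg[OF cfun.subspace_scale[OF subspace_inv_fun f] that] avg[OF f that]
      by (simp add: sum_distrib_left mult.assoc cscale_apply)
    have ff: "sphere_inner M f f =
        of_real ((\<Sum>r\<in>R. (cmod (f (last_basis v* r)))\<^sup>2) / real (card R))"
      unfolding avg[OF f f] by (simp add: complex_norm_square del: of_real_power)
    then show "0 \<le> Re (sphere_inner M f f)"
      by (simp add: sum_nonneg)
    show "f = 0" if "sphere_inner M f f = 0"
    proof -
      have "(\<Sum>r\<in>R. (cmod (f (last_basis v* r)))\<^sup>2) / real (card R) = 0"
        using that unfolding ff of_real_eq_0_iff .
      then have "f (last_basis v* r) = 0" if "r \<in> R" for r
        using R that card by (simp add: sum_nonneg_eq_0_iff)
      then have "f x = 0" if "x \<in> unit_sphere" for x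
        using ex[OF that] f by auto
      then show ?thesis
        using inv_fun_outside[OF f] by (auto simp: fun_eq_iff)
    qed
    assume g: "g \<in> inv_fun m"
    show "sphere_inner M g f = cnj (sphere_inner M f g)"
      by (simp add: avg f g mult.commute)
    show "sphere_inner M (f + g) h = sphere_inner M f h + sphere_inner M g h" if "h \<in> inv_fun m"
      using avg[OF cfun.subspace_add[OF subspace_inv_fun f g] that] avg[OF f that] avg[OF g that]
      by (simp add: distrib_right sum.distrib add_divide_distrib)
  qed
qed

lemma right_translate_inv_fun:
  assumes "g \<in> GLO" "f \<in> inv_fun m"
  shows "right_translate g f \<in> inv_fun m"
proof -
  have "f (x v* k v* g) = f (x v* g)" if "x \<in> unit_sphere" "k \<in> congruence_subgroup m" for x k
  proof -
    have "x v* k v* g = x v* g v* (matrix_inv g ** k ** g)"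
      using assms(1) by (simp add: vector_matrix_mul_assoc flip: matrix_mul_assoc)
    then show ?thesis
      using inv_fun_mult[OF assms(2) _ congruence_subgroup_conj[OF assms(1) that(2)]] that(1) assms(1)
      by simp
  qed
  then show ?thesis
    using assms by (auto simp: inv_fun_def right_translate_def)
qed

lemma sphere_inner_right_translate:
  assumes "haar_prob M" "g \<in> GLO" "f \<in> inv_fun m" "h \<in> inv_fun m"
  shows "sphere_inner M (right_translate g f) (right_translate g h) = sphere_inner M f h"
proof -
  have "(LINT k|M. f (last_basis v* (k ** g)) * cnj (h (last_basis v* (k ** g)))) =
      (LINT k|M. f (last_basis v* k) * cnj (h (last_basis v* k)))"
    by (rule haar_right_invariant[where m=m and F="\<lambda>k. f (last_basis v* k) * cnj (h (last_basis v* k))", OF assms(1,2)])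
      (intro arg_cong2[of _ _ _ _ "\<lambda>a b. a * cnj b"] inv_fun_cong[OF assms(3)] inv_fun_cong[OF assms(4)])
  then show ?thesis
    by (simp add: sphere_inner_def right_translate_def vector_matrix_mul_assoc)
qed

text \<open>With a unit coordinate of \<open>x\<close> as pivot, \<open>move_vec\<close> reaches
  every sufficiently close point of the sphere by an element of the congruence subgroup.\<close>

lemma inv_fun_smooth: "inv_fun m \<subseteq> (smooth_fun :: ('a::nonarch_local_field ^ 'n::{finite,linorder} \<Rightarrow> complex) set)"
proof
  fix f :: "('a, 'n) vec \<Rightarrow> complex" assume f: "f \<in> inv_fun m"
  have "\<exists>U. open U \<and> x \<in> U \<and> f constant_on (U \<inter> unit_sphere)" if x: "x \<in> unit_sphere" for x
  proof (intro exI conjI)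
    let ?U = "\<Inter>i. {y. dist (y $ i) (x $ i) < absv (unif::'a) ^ Suc m}"
    show "open ?U"
      by (intro open_INT ballI finite open_Collect_less continuous_intros)
    show "x \<in> ?U"
      using absv_unif_pos[where 'a='a] by simp
    obtain r where r: "absv (x $ r) = 1"
      using x by (auto simp: unit_sphere_iff)
    have "f y = f x" if y: "y \<in> ?U" "y \<in> unit_sphere" for y
    proof -
      have d: "absv (y $ i - x $ i) < absv (unif::'a) ^ Suc m" for i
        using y(1) by (auto simp: dist_absv)
      have m: "absv (unif::'a) ^ Suc m \<le> absv (unif::'a) ^ m" "absv (unif::'a) ^ Suc m \<le> 1"
        by (rule unif_power_antimono, simp) (rule unif_power_le_1)
      have yr: "absv (y $ r) = absv (x $ r)"
        using d[of r] m(2) r by (intro absv_eq_of_diff_less) linarith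
      obtain k where "y = x v* k"
        and k: "\<And>m. (\<And>i. absv (y $ i - x $ i) \<le> absv (unif::'a) ^ m * absv (x $ r)) \<Longrightarrow> k \<in> congruence_subgroup m"
      proof (rule move_vec[of x r y])
        show "absv (y $ i - x $ i) \<le> absv (x $ r)" for i
          using d[of i] m(2) r by linarith
      qed (use r yr in auto)
      moreover have "k \<in> congruence_subgroup m"
        using order_trans[OF less_imp_le[OF d] m(1)] r by (intro k) simp
      ultimately show ?thesis
        using inv_fun_mult[OF f x] by simp
    qed
    then show "f constant_on (?U \<inter> unit_sphere)"
      unfolding constant_on_def by blast
  qed
  then show "f \<in> smooth_fun"
    using f by (simp add: smooth_fun_def inv_fun_def)
qed

section \<open>Characters\<close>

text \<open>The multiplicative group of the complex numbers has no small subgroups: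
  \<open>w * w - 1 = (w + 1) * (w - 1)\<close>, and near 1 the first factor has norm at least 3/2,
  so repeated squaring drives a power of \<open>z\<close> away from 1 unless
  \<open>z = 1\<close>.\<close>

lemma near_one_imp_one:
  fixes z :: complex
  assumes "\<And>i::nat. norm (z ^ i - 1) \<le> 1 / 2"
  shows "z = 1"
proof (rule ccontr)
  assume "z \<noteq> 1"
  have grow: "(3 / 2) ^ i * norm (z - 1) \<le> norm (z ^ (2 ^ i) - 1)" for i
  proof (induction i)
    case (Suc i)
    let ?w = "z ^ (2 ^ i)"
    have "norm (?w - 1 + 2) \<ge> 3 / 2"
      using norm_triangle_ineq2[of 2 "1 - ?w"] assms[of "2 ^ i"] norm_minus_commute[of ?w 1]
      by (simp add: algebra_simps)
    moreover have "z ^ (2 ^ Suc i) = ?w * ?w"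
      by (simp add: mult_2 power_add)
    then have "z ^ (2 ^ Suc i) - 1 = (?w - 1 + 2) * (?w - 1)"
      by (simp add: algebra_simps)
    ultimately show ?case
      using mult_mono[OF _ Suc, of "3 / 2" "norm (?w - 1 + 2)"] by (simp add: norm_mult mult.assoc)
  qed simp
  obtain i where "1 / norm (z - 1) < (3 / 2) ^ i"
    using real_arch_pow[of "3 / 2" "1 / norm (z - 1)"] by auto
  then have "1 < (3 / 2) ^ i * norm (z - 1)"
    using \<open>z \<noteq> 1\<close> by (simp add: divide_simps)
  with grow[of i] assms[of "2 ^ i"] show False
    by simp
qed

text \<open>One formula for both cases of \<open>cond_exp\<close>: at \<open>m = 0\<close> every
  unit satisfies the distance bound, and for \<open>m > 0\<close> the elements within that bound are
  the \<open>1 + x\<close> with \<open>x\<close> in the power of the maximal ideal.\<close>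

definition trivial_level :: "('a::nonarch_local_field \<Rightarrow> complex) \<Rightarrow> nat \<Rightarrow> bool" where
  "trivial_level \<omega> m \<longleftrightarrow> (\<forall>a. absv a = 1 \<longrightarrow> absv (a - 1) \<le> absv (unif::'a) ^ m \<longrightarrow> \<omega> a = 1)"

lemma character_mult:
  "\<omega> \<in> unit_characters \<Longrightarrow> absv a = 1 \<Longrightarrow> absv b = 1 \<Longrightarrow> \<omega> (a * b) = \<omega> a * \<omega> b"
  by (simp add: unit_characters_def int_units_iff)

lemma character_nonzero: "\<omega> \<in> unit_characters \<Longrightarrow> absv a = 1 \<Longrightarrow> \<omega> a \<noteq> 0"
  by (simp add: unit_characters_def int_units_iff)

lemma character_one: "\<omega> \<in> unit_characters \<Longrightarrow> \<omega> 1 = 1"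
  using character_mult[of \<omega> 1 1] character_nonzero[of \<omega> 1] by simp

text \<open>Continuity at 1 sends a small congruence class of 1 into a disc of radius 1/2 around 1.
  The class is closed under powers, so \<open>near_one_imp_one\<close> applies. This makes the
  \<open>LEAST\<close> in \<open>cond_exp\<close> meaningful.\<close>

lemma trivial_level_exists:
  fixes \<omega> :: "'a::nonarch_local_field \<Rightarrow> complex"
  assumes "\<omega> \<in> unit_characters"
  shows "\<exists>m. trivial_level \<omega> m"
proof -
  have "continuous_on int_units \<omega>" "1 \<in> int_units"
    using assms by (auto simp: unit_characters_def int_units_iff)
  then obtain d where d: "d > 0" "\<And>a. a \<in> int_units \<Longrightarrow> dist a 1 < d \<Longrightarrow> dist (\<omega> a) (\<omega> 1) < 1 / 2"
    unfolding continuous_on_iff by (metis zero_less_divide_1_iff zero_less_numeral)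
  obtain m where m: "absv (unif::'a) ^ m < d"
    using real_arch_pow_inv[OF d(1) absv_unif_less_1] by blast
  have "\<omega> a = 1" if a: "absv a = 1" "absv (a - 1) \<le> absv (unif::'a) ^ m" for a
  proof (rule near_one_imp_one)
    fix i :: nat
    have i: "absv (a ^ i) = 1 \<and> absv (a ^ i - 1) \<le> absv (unif::'a) ^ m \<and> \<omega> (a ^ i) = \<omega> a ^ i"
    proof (induction i)
      case 0
      then show ?case
        using character_one[OF assms] by simp
    next
      case (Suc i)
      have "a ^ Suc i - 1 = a * (a ^ i - 1) + (a - 1)"
        by (simp add: algebra_simps)
      also have "absv \<dots> \<le> absv (unif::'a) ^ m"
        using Suc a by (intro absv_add_le) (simp_all add: absv_mult)
      finally show ?case
        using Suc a character_mult[OF assms, of a "a ^ i"] by (simp add: absv_mult)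
    qed
    then have "dist (\<omega> (a ^ i)) (\<omega> 1) < 1 / 2"
      using m by (intro d(2)) (auto simp: int_units_iff dist_absv)
    then show "norm (\<omega> a ^ i - 1) \<le> 1 / 2"
      using i character_one[OF assms] by (simp add: dist_norm)
  qed
  then show ?thesis
    by (auto simp: trivial_level_def)
qed

lemma cond_exp_eq: "cond_exp \<omega> = (LEAST m. trivial_level \<omega> m)"
proof -
  have "(if m = 0 then \<forall>a\<in>int_units. \<omega> a = 1 else \<forall>x\<in>max_ideal_power m. \<omega> (1 + x) = 1)
      \<longleftrightarrow> trivial_level \<omega> m" for m
  proof (cases "m = 0")
    case True
    have "absv (a - 1) \<le> 1" if "absv a = 1" for a :: 'a
      using that by (intro absv_diff_le) auto
    then show ?thesis
      using True by (auto simp: trivial_level_def int_units_iff)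
  next
    case False
    then have lt: "absv (unif::'a) ^ m < 1"
      using absv_unif_less_1[where 'a='a] by (simp add: power_Suc_less_one power_less_one_iff)
    have "absv (1 + x) = 1" if "absv x \<le> absv (unif::'a) ^ m" for x :: 'a
      using that lt absv_eq_of_diff_less[of "1 + x" 1] by simp
    then have "(\<forall>x\<in>max_ideal_power m. \<omega> (1 + x) = 1) \<longleftrightarrow> trivial_level \<omega> m"
      unfolding trivial_level_def max_ideal_power_iff Ball_def
      by (metis add.commute add_diff_cancel_left' diff_add_cancel)
    then show ?thesis
      using False by simp
  qed
  then show ?thesis
    by (simp add: cond_exp_def)
qed

lemma trivial_level_cond_exp:
  assumes "\<omega> \<in> unit_characters" "cond_exp \<omega> \<le> m"
  shows "trivial_level \<omega> m"
proof -
  have "trivial_level \<omega> (cond_exp \<omega>)"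
    unfolding cond_exp_eq using trivial_level_exists[OF assms(1)] by (metis LeastI)
  then show ?thesis
    using unif_power_antimono[OF assms(2), where 'a='a]
    unfolding trivial_level_def by (meson order_trans)
qed

lemma not_trivial_level: "m < cond_exp \<omega> \<Longrightarrow> \<not> trivial_level \<omega> m"
  unfolding cond_exp_eq by (rule not_less_Least)

section \<open>Functions of a given level and character\<close>

lemma smooth_fun_char_level_eq:
  "smooth_fun_char_level \<omega> m = {f \<in> inv_fun m. \<forall>x\<in>unit_sphere. \<forall>a. absv a = 1 \<longrightarrow> f (a *s x) = \<omega> a * f x}"
  using inv_fun_smooth[of m]
  unfolding smooth_fun_char_level_def inv_fun_def smooth_fun_def by (auto simp: int_units_iff)

lemma level_inv_fun: "f \<in> smooth_fun_char_level \<omega> m \<Longrightarrow> f \<in> inv_fun m"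
  by (simp add: smooth_fun_char_level_eq)

lemma level_scale:
  fixes f :: "'a::nonarch_local_field ^ 'n::{finite,linorder} \<Rightarrow> complex"
  shows "f \<in> smooth_fun_char_level \<omega> m \<Longrightarrow> x \<in> unit_sphere \<Longrightarrow> absv a = 1 \<Longrightarrow> f (a *s x) = \<omega> a * f x"
  by (simp add: smooth_fun_char_level_eq)

lemma level_mono:
  "m \<le> m' \<Longrightarrow> smooth_fun_char_level \<omega> m \<subseteq>
     (smooth_fun_char_level \<omega> m' :: ('a::nonarch_local_field ^ 'n::{finite,linorder} \<Rightarrow> complex) set)"
  using inv_fun_mono[of m m', where 'a='a and 'b='n] by (auto simp: smooth_fun_char_level_eq)

lemma subspace_level:
  "cfun.subspace (smooth_fun_char_level \<omega> m :: ('a::nonarch_local_field ^ 'n::{finite,linorder} \<Rightarrow> complex) set)"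
proof -
  have "cfun.subspace {f :: ('a, 'n) vec \<Rightarrow> complex. \<forall>x\<in>unit_sphere. \<forall>a. absv a = 1 \<longrightarrow> f (a *s x) = \<omega> a * f x}"
    unfolding cfun.subspace_def by (auto simp: cscale_apply algebra_simps)
  from cfun.subspace_inter[OF subspace_inv_fun[of m] this] show ?thesis
    by (simp add: smooth_fun_char_level_eq Int_def)
qed

lemma right_translate_level:
  fixes f :: "'a::nonarch_local_field ^ 'n::{finite,linorder} \<Rightarrow> complex"
  shows "g \<in> GLO \<Longrightarrow> f \<in> smooth_fun_char_level \<omega> m \<Longrightarrow> right_translate g f \<in> smooth_fun_char_level \<omega> m"
  unfolding smooth_fun_char_level_eq
  by (auto simp: right_translate_inv_fun) (simp add: right_translate_def scalar_vector_matrix_assoc)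

lemma right_translate_inverse:
  "g \<in> GLO \<Longrightarrow> right_translate g (right_translate (matrix_inv g) f) = f"
  by (simp add: right_translate_def)

lemma level_space_subset: "level_space M \<omega> m \<subseteq> smooth_fun_char_level \<omega> m"
  by (auto simp: level_space_def)

lemma level_space_inv_fun: "f \<in> level_space M \<omega> m \<Longrightarrow> f \<in> inv_fun m"
  using level_space_subset level_inv_fun by blast

lemma level_space_orthogonal:
  "f \<in> level_space M \<omega> m \<Longrightarrow> cond_exp \<omega> < m \<Longrightarrow> g \<in> smooth_fun_char_level \<omega> (m - 1) \<Longrightarrow> sphere_inner M f g = 0"
  by (auto simp: level_space_def)

lemma subspace_level_space:
  fixes M :: "('a::nonarch_local_field ^ 'n::{finite,linorder} ^ 'n::{finite,linorder}) measure"
  assumes "haar_prob M"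
  shows "cfun.subspace (level_space M \<omega> m)"
proof (cases "m = cond_exp \<omega>")
  case True
  then show ?thesis
    by (simp add: level_space_def subspace_level)
next
  case False
  interpret hermitian_form "inv_fun m :: (('a, 'n) vec \<Rightarrow> complex) set" "sphere_inner M"
    using assms by (rule hermitian_inv_fun)
  have *: "g \<in> inv_fun m" if "g \<in> smooth_fun_char_level \<omega> (m - 1)" for g :: "('a, 'n) vec \<Rightarrow> complex"
    using level_inv_fun[OF that] inv_fun_mono[of "m - 1" m] by auto
  have L: "level_space M \<omega> m = {f \<in> smooth_fun_char_level \<omega> m.
      \<forall>g\<in>smooth_fun_char_level \<omega> (m - 1). sphere_inner M f g = 0}"
    using False by (simp add: level_space_def)
  show ?thesis
    unfolding cfun.subspace_def
  proof (intro conjI ballI allI)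
    show "0 \<in> level_space M \<omega> m"
      unfolding L using cfun.subspace_0[OF subspace_level] ip_zero * by blast
  next
    fix f g assume fg: "f \<in> level_space M \<omega> m" "g \<in> level_space M \<omega> m"
    then have "f + g \<in> smooth_fun_char_level \<omega> m"
      by (intro cfun.subspace_add[OF subspace_level]) (auto simp: L)
    moreover have "sphere_inner M (f + g) h = 0" if "h \<in> smooth_fun_char_level \<omega> (m - 1)" for h
      using ip_add[OF level_space_inv_fun[OF fg(1)] level_space_inv_fun[OF fg(2)] *[OF that]] fg that
      by (simp add: L)
    ultimately show "f + g \<in> level_space M \<omega> m"
      unfolding L by (intro CollectI conjI ballI)
  next
    fix c f assume f: "f \<in> level_space M \<omega> m"
    then have "cscale c f \<in> smooth_fun_char_level \<omega> m"
      by (intro cfun.subspace_scale[OF subspace_level]) (auto simp: L)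
    moreover have "sphere_inner M (cscale c f) h = 0" if "h \<in> smooth_fun_char_level \<omega> (m - 1)" for h
      using ip_scale[OF level_space_inv_fun[OF f] *[OF that], of c] f that by (simp add: L)
    ultimately show "cscale c f \<in> level_space M \<omega> m"
      unfolding L by (intro CollectI conjI ballI)
  qed
qed

text \<open>Translation is unitary and its inverse preserves the lower level, so the orthogonality
  condition can be shifted to the other argument.\<close>

lemma right_translate_level_space:
  fixes M :: "('a::nonarch_local_field ^ 'n::{finite,linorder} ^ 'n::{finite,linorder}) measure"
  assumes "haar_prob M" "k \<in> GLO" and f: "f \<in> level_space M \<omega> m"
  shows "right_translate k f \<in> level_space M \<omega> m"
proof -
  have "right_translate k f \<in> smooth_fun_char_level \<omega> m"
    using assms level_space_subset by (blast intro: right_translate_level)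
  moreover have "sphere_inner M (right_translate k f) h = 0"
    if "m \<noteq> cond_exp \<omega>" and h: "h \<in> smooth_fun_char_level \<omega> (m - 1)" for h
  proof -
    have h': "right_translate (matrix_inv k) h \<in> smooth_fun_char_level \<omega> (m - 1)"
      using assms(2) h by (intro right_translate_level) auto
    then have "right_translate (matrix_inv k) h \<in> inv_fun m"
      using level_mono[of "m - 1" m \<omega>] level_inv_fun by auto
    from sphere_inner_right_translate[OF assms(1,2) level_space_inv_fun[OF f] this]
    show ?thesis
      using that(1) f h' assms(2) by (simp add: right_translate_inverse level_space_def)
  qed
  ultimately show ?thesis
    by (auto simp: level_space_def)
qed

text \<open>On the sphere these are the points that reduce to a multiple of
  \<open>last_basis\<close> modulo the \<open>m\<close>-th power of the maximal ideal; for
  \<open>m = 0\<close> that is the whole sphere. The non-last coordinates measure the distance from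
  the line through \<open>last_basis\<close>.\<close>

definition near :: "nat \<Rightarrow> 'a::nonarch_local_field ^ 'n::{finite,linorder} \<Rightarrow> bool" where
  "near m x \<longleftrightarrow> (\<forall>i. i \<noteq> last_index \<longrightarrow> absv (x $ i) \<le> absv (unif::'a) ^ m)"

lemma near_last_unit:
  assumes "near m x" "m > 0" "x \<in> unit_sphere"
  shows "absv (x $ last_index) = 1"
proof -
  have "absv (unif::'a) ^ m < 1"
    using assms(2) absv_unif_less_1[where 'a='a] by (simp add: power_less_one_iff)
  then have "absv (x $ i) \<noteq> 1" if "i \<noteq> last_index" for i
    using assms(1) that unfolding near_def by (metis not_le)
  then show ?thesis
    using assms(3) unfolding unit_sphere_iff by metis
qed

lemma congruence_subgroup_diff:
  fixes x :: "'a::nonarch_local_field ^ 'n::{finite,linorder}"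
  assumes "x \<in> unit_sphere" "k \<in> congruence_subgroup m"
  shows "absv ((x v* k) $ i - x $ i) \<le> absv (unif::'a) ^ m"
proof -
  have "(x v* k) $ i - x $ i = (x v* k) $ i - (x v* mat 1) $ i"
    by simp
  also have "\<dots> = (\<Sum>j\<in>UNIV. x $ j * (k $ j $ i - mat 1 $ j $ i))"
    by (simp only: vector_matrix_mult_def vec_lambda_beta right_diff_distrib sum_subtractf)
  also have "absv \<dots> \<le> absv (unif::'a) ^ m"
  proof (intro absv_sum_le)
    fix j
    have "absv (x $ j) * absv (k $ j $ i - mat 1 $ j $ i) \<le> 1 * absv (unif::'a) ^ m"
      using assms by (intro mult_mono) (auto simp: unit_sphere_iff congruence_subgroup_iff mat_cong_def)
    then show "absv (x $ j * (k $ j $ i - mat 1 $ j $ i)) \<le> absv (unif::'a) ^ m"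
      by (simp add: absv_mult)
  qed simp
  finally show ?thesis .
qed

lemma near_congruence_subgroup:
  fixes x :: "'a::nonarch_local_field ^ 'n::{finite,linorder}"
  assumes "x \<in> unit_sphere" "k \<in> congruence_subgroup m"
  shows "near m (x v* k) \<longleftrightarrow> near m x"
proof -
  have "absv ((x v* k) $ i) \<le> absv (unif::'a) ^ m \<longleftrightarrow> absv (x $ i) \<le> absv (unif::'a) ^ m" for i
    using absv_add_le[OF congruence_subgroup_diff[OF assms, of i], of "x $ i"]
      absv_diff_le[of "(x v* k) $ i" _ "(x v* k) $ i - x $ i", OF _ congruence_subgroup_diff[OF assms, of i]]
    by auto
  then show ?thesis
    by (simp add: near_def)
qed

lemma near_scale: "absv a = 1 \<Longrightarrow> near m (a *s x) \<longleftrightarrow> near m x"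
  by (simp add: near_def absv_mult)

text \<open>At level \<open>0\<close> the last coordinate need not be a unit, but then the character is trivial.\<close>

definition char_fun ::
    "('a::nonarch_local_field \<Rightarrow> complex) \<Rightarrow> nat \<Rightarrow> 'a ^ 'n::{finite,linorder} \<Rightarrow> complex" where
  "char_fun \<omega> m x = (if x \<in> unit_sphere \<and> near m x then if m = 0 then 1 else \<omega> (x $ last_index) else 0)"

lemma near_0: "x \<in> unit_sphere \<Longrightarrow> near 0 x"
  by (simp add: near_def unit_sphere_iff)

lemma char_fun_level:
  fixes \<omega> :: "'a::nonarch_local_field \<Rightarrow> complex"
  assumes "\<omega> \<in> unit_characters" "trivial_level \<omega> m"
  shows "char_fun \<omega> m \<in> (smooth_fun_char_level \<omega> m :: ('a ^ 'n::{finite,linorder} \<Rightarrow> complex) set)"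
proof -
  have "char_fun \<omega> m (x v* k) = char_fun \<omega> m x"
    if x: "x \<in> unit_sphere" and k: "k \<in> congruence_subgroup m" for x :: "('a, 'n) vec" and k
  proof (cases "near m x \<and> m > 0")
    case True
    then have unit: "absv (x $ last_index) = 1" "absv ((x v* k) $ last_index) = 1"
      using x k near_last_unit[of m x] near_last_unit[of m "x v* k"] near_congruence_subgroup[OF x k]
      by (simp_all add: congruence_subgroup_iff)
    \<comment> \<open>\<open>x\<close> and \<open>x v* k\<close> are congruent to order
      \<open>m\<close>, so the ratio of their unit last coordinates is congruent to 1, where
      \<open>trivial_level\<close> makes the character 1.\<close>
    define b where "b = (x v* k) $ last_index / x $ last_index"
    have b: "absv b = 1" "x $ last_index * b = (x v* k) $ last_index"
      using unit by (auto simp: b_def)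
    have "absv (b - 1) = absv (x $ last_index * (b - 1))"
      using unit by (simp add: absv_mult)
    also have "\<dots> = absv ((x v* k) $ last_index - x $ last_index)"
      by (simp add: right_diff_distrib b)
    also have "\<dots> \<le> absv (unif::'a) ^ m"
      by (rule congruence_subgroup_diff[OF x k])
    finally have "\<omega> b = 1"
      using assms(2) b(1) by (simp add: trivial_level_def)
    then have "\<omega> ((x v* k) $ last_index) = \<omega> (x $ last_index)"
      using character_mult[OF assms(1) unit(1) b(1)] b(2) by simp
    then show ?thesis
      using x k near_congruence_subgroup[OF x k] by (simp add: char_fun_def congruence_subgroup_iff)
  next
    case False
    then show ?thesis
      using x k near_congruence_subgroup[OF x k] by (auto simp: char_fun_def congruence_subgroup_iff)
  qed
  moreover have "char_fun \<omega> m (a *s x) = \<omega> a * char_fun \<omega> m x"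
    if x: "x \<in> unit_sphere" and a: "absv a = 1" for x :: "('a, 'n) vec" and a
  proof (cases "m = 0")
    case True
    have "absv (a - 1) \<le> 1"
      using a by (intro absv_diff_le) auto
    then have "\<omega> a = 1"
      using assms(2) a True by (simp add: trivial_level_def)
    then show ?thesis
      using True x a by (simp add: char_fun_def near_scale)
  next
    case False
    then show ?thesis
      using x a near_last_unit[of m x] character_mult[OF assms(1) a]
      by (simp add: char_fun_def near_scale)
  qed
  ultimately show ?thesis
    by (auto simp: smooth_fun_char_level_eq inv_fun_def char_fun_def)
qed

lemma char_fun_last_basis: "\<omega> \<in> unit_characters \<Longrightarrow> char_fun \<omega> m last_basis = 1"
  by (simp add: char_fun_def near_def last_basis_nth character_one)

text \<open>For \<open>m > 0\<close>, scaling by units and the congruence subgroup together carry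
  \<open>last_basis\<close> to every such \<open>x\<close>; the scaling accounts for the character.
  For \<open>m = 0\<close> the congruence subgroup is all of \<open>GLO\<close>, which is transitive
  on the sphere.\<close>

lemma level_near:
  fixes f :: "'a::nonarch_local_field ^ 'n::{finite,linorder} \<Rightarrow> complex"
  assumes f: "f \<in> smooth_fun_char_level \<omega> m" and x: "x \<in> unit_sphere" "near m x"
  shows "f x = char_fun \<omega> m x * f last_basis"
proof (cases "m = 0")
  case True
  obtain k where "k \<in> GLO" "x = last_basis v* k"
    using sphere_transitive[OF x(1)] .
  then show ?thesis
    using inv_fun_mult[OF level_inv_fun[OF f], of last_basis k] x True
    by (simp add: congruence_subgroup_0 char_fun_def)
next
  case False
  let ?a = "x $ last_index"
  define y where "y = inverse ?a *s x"
  have a: "absv ?a = 1"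
    using near_last_unit x False by auto
  then have "?a \<noteq> 0"
    by auto
  with a have xy: "x = ?a *s y" and y: "y \<in> unit_sphere" "near m y" "y $ last_index = 1"
    using x by (auto simp: y_def vec_eq_iff near_scale)
  have d: "absv (y $ i - last_basis $ i) \<le> absv (unif::'a) ^ m" for i
    using y by (auto simp: near_def last_basis_nth)
  obtain k where k: "y = last_basis v* k"
    "\<And>m. (\<And>i. absv (y $ i - last_basis $ i) \<le> absv (unif::'a) ^ m * absv (last_basis $ last_index :: 'a))
       \<Longrightarrow> k \<in> congruence_subgroup m"
  proof (rule move_vec[of last_basis last_index y])
    show "absv (y $ i - last_basis $ i) \<le> absv (last_basis $ last_index :: 'a)" for i
      using order_trans[OF d unif_power_le_1] by (simp add: last_basis_nth)
  qed (use y in \<open>auto simp: last_basis_nth\<close>)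
  have "k \<in> congruence_subgroup m"
    using d by (intro k(2)) (simp add: last_basis_nth)
  then have "f y = f last_basis"
    using inv_fun_mult[OF level_inv_fun[OF f] last_basis_sphere] k(1) by simp
  then show ?thesis
    using level_scale[OF f y(1) a] xy x False by (simp add: char_fun_def)
qed

section \<open>Multiplicity one\<close>

lemma exists_other_index:
  assumes "CARD('n::{finite,linorder}) \<ge> 2"
  shows "\<exists>p::'n. p \<noteq> last_index"
proof (rule ccontr)
  assume "\<not> ?thesis"
  then have "CARD('n) = card {last_index :: 'n}"
    by (intro arg_cong[of _ _ card]) auto
  then show False
    using assms by simp
qed

lemma mirabolic_move:
  fixes f :: "'a::nonarch_local_field ^ 'n::{finite,linorder} \<Rightarrow> complex"
  assumes f: "\<forall>x\<in>unit_sphere. \<forall>k\<in>mirabolic. f (x v* k) = f x"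
    and x: "x \<in> unit_sphere" "p \<noteq> last_index" "x $ p \<noteq> 0"
    and y: "absv (y $ p) = absv (x $ p)" "\<And>i. absv (y $ i - x $ i) \<le> absv (x $ p)"
  shows "f y = f x"
proof -
  obtain k where "y = x v* k" "p \<noteq> last_index \<Longrightarrow> k \<in> mirabolic"
    using move_vec[OF x(3) y] by metis
  then show ?thesis
    using f x by simp
qed

lemma mirabolic_move2:
  fixes f :: "'a::nonarch_local_field ^ 'n::{finite,linorder} \<Rightarrow> complex"
  assumes f: "\<forall>x\<in>unit_sphere. \<forall>k\<in>mirabolic. f (x v* k) = f x"
    and x: "x \<in> unit_sphere" "p \<noteq> last_index" "x $ p \<noteq> 0" "absv (x $ r) \<le> absv (x $ p)"
    and y: "r \<noteq> last_index" "absv (y $ r) = absv (x $ p)" "\<And>i. absv (y $ i - x $ i) \<le> absv (x $ p)"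
  shows "f y = f x"
proof -
  obtain k l where kl: "y = x v* k v* l" "p \<noteq> last_index \<Longrightarrow> k \<in> mirabolic" "r \<noteq> last_index \<Longrightarrow> l \<in> mirabolic"
    using move_vec2[OF x(3) y(2) x(4) y(3)] by metis
  then have "x v* k \<in> unit_sphere"
    using x by (simp add: mirabolic_GLO)
  then show ?thesis
    using f kl x y by simp
qed

text \<open>Far from the line some pivot \<open>x $ p\<close> has size at least
  \<open>absv unif ^ l\<close>, where \<open>l\<close> is one below the conductor. By minimality of
  the conductor some unit \<open>a\<close>, congruent to 1 to order \<open>l\<close>, has
  \<open>\<omega> a \<noteq> 1\<close>. The pivot is large enough to move \<open>x\<close> to
  \<open>a *s x\<close> within its mirabolic orbit, so \<open>f x = \<omega> a * f x\<close> forces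
  0. Near the line the value at \<open>last_basis\<close> decides.\<close>

lemma mirabolic_invariant_conductor:
  fixes f :: "'a::nonarch_local_field ^ 'n::{finite,linorder} \<Rightarrow> complex"
  assumes f: "f \<in> smooth_fun_char_level \<omega> (cond_exp \<omega>)"
    and inv: "\<forall>x\<in>unit_sphere. \<forall>k\<in>mirabolic. f (x v* k) = f x"
    and f0: "f last_basis = 0"
  shows "f = 0"
proof
  let ?c = "cond_exp \<omega>"
  fix x :: "('a, 'n) vec"
  consider "x \<notin> unit_sphere" | "x \<in> unit_sphere" "near ?c x" | "x \<in> unit_sphere" "\<not> near ?c x"
    by blast
  then show "f x = 0 x"
  proof cases
    case 3
    then have "?c \<noteq> 0"
      using near_0[OF 3(1)] by metis
    then obtain l where l: "?c = Suc l"
      using not0_implies_Suc by blast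
    obtain p where p: "p \<noteq> last_index" "absv (unif::'a) ^ Suc l < absv (x $ p)"
      using 3(2) by (auto simp: near_def l not_le)
    have "\<not> trivial_level \<omega> l"
      using l by (intro not_trivial_level) simp
    then obtain a where a: "absv a = 1" "absv (a - 1) \<le> absv (unif::'a) ^ l" "\<omega> a \<noteq> 1"
      by (auto simp: trivial_level_def)
    have "f (a *s x) = f x"
    proof (rule mirabolic_move[OF inv 3(1) p(1)])
      show "x $ p \<noteq> 0"
        using p(2) by (metis absv_0 not_less absv_nonneg zero_le_power)
      show "absv ((a *s x) $ p) = absv (x $ p)"
        using a by (simp add: absv_mult)
      fix i
      have "(a *s x) $ i - x $ i = (a - 1) * x $ i"
        by (simp add: algebra_simps)
      also have "absv \<dots> \<le> absv (unif::'a) ^ l * 1"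
        unfolding absv_mult using a 3(1) by (intro mult_mono) (auto simp: unit_sphere_iff)
      also have "\<dots> \<le> absv (x $ p)"
        using absv_greater_unif_power[OF p(2)] by simp
      finally show "absv ((a *s x) $ i - x $ i) \<le> absv (x $ p)" .
    qed
    then show ?thesis
      using level_scale[OF f 3(1) a(1)] a(3) by simp
  qed (use level_near[OF f] inv_fun_outside[OF level_inv_fun[OF f]] f0 in auto)
qed

text \<open>
  Above the conductor, a \<open>mirabolic\<close>-invariant \<open>f\<close> vanishing at \<open>last_basis\<close> agrees on its
  support with a function \<open>g\<close> of lower level, so that the inner product of \<open>f\<close> with itself is its
  inner product with \<open>g\<close>.
\<close>

lemma mirabolic_invariant_above_conductor:
  fixes f :: "'a::nonarch_local_field ^ 'n::{finite,linorder} \<Rightarrow> complex"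
  assumes haar: "haar_prob M" and n: "CARD('n) \<ge> 2" and character: "\<omega> \<in> unit_characters"
    and l: "trivial_level \<omega> l"
    and f: "f \<in> smooth_fun_char_level \<omega> (Suc l)"
    and orth: "\<And>g. g \<in> smooth_fun_char_level \<omega> l \<Longrightarrow> sphere_inner M f g = 0"
    and inv: "\<forall>x\<in>unit_sphere. \<forall>k\<in>mirabolic. f (x v* k) = f x"
    and f0: "f last_basis = 0"
  shows "f = 0"
proof -
  interpret hermitian_form "inv_fun (Suc l) :: (('a, 'n) vec \<Rightarrow> complex) set" "sphere_inner M"
    using haar by (rule hermitian_inv_fun)
  let ?c = "absv (unif::'a) ^ l"
  have "?c > 0"
    using absv_unif_pos[where 'a='a] by simp
  obtain p :: 'n where p: "p \<noteq> last_index"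
    using exists_other_index[OF n] by blast
  \<comment> \<open>A sample point of the shell between \<open>near l\<close> and
    \<open>near (Suc l)\<close>: its largest non-last coordinate has absolute value exactly
    \<open>?c\<close>.\<close>
  define v :: "('a, 'n) vec" where "v = (\<chi> i. if i = last_index then 1 else if i = p then unif ^ l else 0)"
  have v: "v \<in> unit_sphere" "v $ p = unif ^ l" "v $ last_index = 1"
    using p by (auto simp: v_def unit_sphere_iff)
  have v_le: "absv (v $ i) \<le> ?c" if "i \<noteq> last_index" for i
    using that \<open>?c > 0\<close> by (auto simp: v_def)
  \<comment> \<open>Inside \<open>near l\<close> the values on the shell are continued inwards by
    the character. This changes \<open>f\<close> only within \<open>near (Suc l)\<close>, where
    \<open>f\<close> vanishes.\<close>
  define g where "g x = (if x \<in> unit_sphere \<and> \<not> near l x then f x else f v * char_fun \<omega> l x)" for x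
  have ch: "char_fun \<omega> l \<in> smooth_fun_char_level \<omega> l"
    using character l by (rule char_fun_level)
  \<comment> \<open>Once the last coordinate is scaled to 1, every shell point lies in the mirabolic
    orbit of \<open>v\<close>, and the scaling contributes the character. For \<open>l = 0\<close>
    the last coordinate may fail to be a unit, but \<open>char_fun\<close> is then constantly 1 on
    the sphere and no scaling takes place.\<close>
  have shell: "f x = f v * char_fun \<omega> l x" if x: "x \<in> unit_sphere" "near l x" "\<not> near (Suc l) x" for x
  proof -
    obtain r where r: "r \<noteq> last_index" "absv (unif::'a) ^ Suc l < absv (x $ r)"
      using x(3) by (auto simp: near_def not_le)
    have xr: "absv (x $ r) = ?c"
      using absv_greater_unif_power[OF r(2)] x(2) r(1) by (auto simp: near_def)
    have move: "f y = f v" if "absv (y $ r) = ?c" "\<And>i. absv (y $ i - v $ i) \<le> ?c" for y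
      by (rule mirabolic_move2[OF inv v(1) p _ _ r(1)]) (use v v_le r that in auto)
    show ?thesis
    proof (cases "l = 0")
      case True
      have "absv (x $ i - v $ i) \<le> ?c" for i
        using x(1) v(1) True by (intro absv_diff_le) (auto simp: unit_sphere_iff)
      then show ?thesis
        using move[OF xr] True x by (simp add: char_fun_def)
    next
      case False
      let ?a = "x $ last_index"
      define y where "y = inverse ?a *s x"
      have a: "absv ?a = 1"
        using near_last_unit x False by auto
      then have "?a \<noteq> 0"
        by auto
      with a have xy: "x = ?a *s y" and y: "y \<in> unit_sphere" "near l y" "y $ last_index = 1" "absv (y $ r) = ?c"
        using x xr by (auto simp: y_def vec_eq_iff near_scale absv_mult)
      have "absv (y $ i - v $ i) \<le> ?c" for i
        using y v v_le[of i] \<open>?c > 0\<close> by (cases "i = last_index") (auto simp: near_def intro!: absv_diff_le)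
      then show ?thesis
        using move[OF y(4)] level_scale[OF f y(1) a] xy x False by (simp add: char_fun_def mult.commute)
    qed
  qed
  have "g (x v* k) = g x" if x: "x \<in> unit_sphere" and k: "k \<in> congruence_subgroup l" for x k
  proof (cases "near l x")
    case True
    then show ?thesis
      using inv_fun_mult[OF level_inv_fun[OF ch] x k] near_congruence_subgroup[OF x k] by (simp add: g_def)
  next
    case False
    then obtain r where r: "r \<noteq> last_index" "?c < absv (x $ r)"
      by (auto simp: near_def not_le)
    \<comment> \<open>Outside \<open>near l\<close> a congruence of level \<open>l\<close> displaces
      \<open>x\<close> by less than its pivot, so mirabolic invariance of \<open>f\<close> stands in
      for the congruence invariance that is only known at level \<open>Suc l\<close>.\<close>
    have d: "absv ((x v* k) $ i - x $ i) < absv (x $ r)" for i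
      using congruence_subgroup_diff[OF x k, of i] r(2) by linarith
    have "absv (x $ r) \<noteq> 0"
      using r(2) \<open>?c > 0\<close> by linarith
    then have "x $ r \<noteq> 0"
      by simp
    then have "f (x v* k) = f x"
      using absv_eq_of_diff_less[OF d[of r]] less_imp_le[OF d] by (rule mirabolic_move[OF inv x r(1)])
    then show ?thesis
      using False near_congruence_subgroup[OF x k] x k by (simp add: g_def congruence_subgroup_iff)
  qed
  moreover have "g (a *s x) = \<omega> a * g x" if "x \<in> unit_sphere" "absv a = 1" for a x
    using that level_scale[OF f that] level_scale[OF ch that] by (simp add: g_def near_scale)
  moreover have "g x = 0" if "x \<notin> unit_sphere" for x
    using that by (simp add: g_def char_fun_def)
  ultimately have "g \<in> smooth_fun_char_level \<omega> l"
    by (simp add: smooth_fun_char_level_eq inv_fun_def)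
  have fg: "f x * cnj (g x) = f x * cnj (f x)" if "x \<in> unit_sphere" for x
  proof (cases "near (Suc l) x")
    case True
    then show ?thesis
      using level_near[OF f that] f0 by simp
  next
    case False
    then have "g x = f x"
      using shell[OF that] that by (auto simp: g_def)
    then show ?thesis
      by simp
  qed
  have "sphere_inner M f f = sphere_inner M f g"
    unfolding sphere_inner_def
    by (intro Bochner_Integration.integral_cong refl fg[symmetric]) (simp add: haar_space[OF haar])
  also have "\<dots> = 0"
    by (rule orth) fact
  finally show ?thesis
    using ip_definite level_inv_fun[OF f] by blast
qed

lemma mirabolic_invariant_eq_0:
  fixes f :: "'a::nonarch_local_field ^ 'n::{finite,linorder} \<Rightarrow> complex"
  assumes "haar_prob M" "CARD('n) \<ge> 2" "\<omega> \<in> unit_characters" "cond_exp \<omega> \<le> m"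
    and f: "f \<in> level_space M \<omega> m"
    and inv: "\<forall>x\<in>unit_sphere. \<forall>k\<in>mirabolic. f (x v* k) = f x" "f last_basis = 0"
  shows "f = 0"
proof (cases "m = cond_exp \<omega>")
  case True
  then show ?thesis
    using f inv by (intro mirabolic_invariant_conductor[of f \<omega>]) (auto simp: level_space_def)
next
  case False
  then obtain l where l: "m = Suc l" "cond_exp \<omega> \<le> l"
    using assms(4) by (cases m) auto
  show ?thesis
  proof (rule mirabolic_invariant_above_conductor[OF assms(1-3) _ _ _ inv])
    show "trivial_level \<omega> l"
      using assms(3) l(2) by (rule trivial_level_cond_exp)
    show "f \<in> smooth_fun_char_level \<omega> (Suc l)"
      using f level_space_subset l(1) by blast
    show "sphere_inner M f g = 0" if "g \<in> smooth_fun_char_level \<omega> l" for g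
      using level_space_orthogonal[OF f] that l by simp
  qed
qed

text \<open>This keeps the dimension away from 0. Above the conductor the witness is the
  \<open>char_fun\<close> of level \<open>m\<close> minus its projection to the level below.\<close>

lemma level_space_nonzero:
  fixes M :: "('a::nonarch_local_field ^ 'n::{finite,linorder} ^ 'n::{finite,linorder}) measure"
  assumes "haar_prob M" "CARD('n) \<ge> 2" "\<omega> \<in> unit_characters" "cond_exp \<omega> \<le> m"
  shows "\<exists>f\<in>level_space M \<omega> m. f \<noteq> 0"
proof (cases "m = cond_exp \<omega>")
  case True
  have "char_fun \<omega> m \<in> level_space M \<omega> m"
    using assms True by (simp add: level_space_def char_fun_level trivial_level_cond_exp)
  moreover have "char_fun \<omega> m \<noteq> (0 :: ('a, 'n) vec \<Rightarrow> complex)"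
    using char_fun_last_basis[OF assms(3), of m, where 'b='n] by (metis zero_fun_apply zero_neq_one)
  ultimately show ?thesis
    by blast
next
  case False
  then obtain l where l: "m = Suc l" "cond_exp \<omega> \<le> l"
    using assms(4) by (cases m) auto
  interpret big: hermitian_form "inv_fun m :: (('a, 'n) vec \<Rightarrow> complex) set" "sphere_inner M"
    using assms(1) by (rule hermitian_inv_fun)
  have sub: "smooth_fun_char_level \<omega> l \<subseteq> (inv_fun m :: (('a, 'n) vec \<Rightarrow> complex) set)"
    using level_mono[of l m \<omega>] level_inv_fun l(1) by fastforce
  interpret low: hermitian_form "smooth_fun_char_level \<omega> l :: (('a, 'n) vec \<Rightarrow> complex) set" "sphere_inner M"
    by (rule big.subform[OF subspace_level sub])
  obtain C where C: "low.orthonormal C" "cfun.span C = smooth_fun_char_level \<omega> l"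
    "card C = cdim (smooth_fun_char_level \<omega> l :: (('a, 'n) vec \<Rightarrow> complex) set)"
    by (rule low.orthonormal_basis)
  have C': "big.orthonormal C"
    using C(1) sub by (auto simp: low.orthonormal_def big.orthonormal_def)
  let ?\<phi> = "char_fun \<omega> m :: ('a, 'n) vec \<Rightarrow> complex"
  have \<phi>: "?\<phi> \<in> smooth_fun_char_level \<omega> m"
    using assms by (simp add: char_fun_level trivial_level_cond_exp)
  have pr: "big.proj C ?\<phi> \<in> smooth_fun_char_level \<omega> l"
    using big.proj_in_span[of C ?\<phi>] C(2) by simp
  let ?f = "?\<phi> - big.proj C ?\<phi>"
  have "?f \<in> smooth_fun_char_level \<omega> m"
    using level_mono[of l m \<omega>] pr \<phi> l(1) by (intro cfun.subspace_diff[OF subspace_level]) auto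
  moreover have "sphere_inner M ?f g = 0" if "g \<in> smooth_fun_char_level \<omega> l" for g
    using big.ip_diff_proj[OF C' level_inv_fun[OF \<phi>]] that C(2) by simp
  ultimately have "?f \<in> level_space M \<omega> m"
    using False l by (simp add: level_space_def)
  moreover have "?f \<noteq> 0"
  \<comment> \<open>Otherwise \<open>char_fun\<close> of level \<open>m\<close> would be of level
    \<open>l\<close>, and \<open>level_near\<close> would spread its value at
    \<open>last_basis\<close> over all of \<open>near l\<close>, including the point
    \<open>v\<close> outside its support.\<close>
  proof
    assume "?f = 0"
    then have low: "?\<phi> \<in> smooth_fun_char_level \<omega> l"
      using pr by simp
    obtain p :: 'n where p: "p \<noteq> last_index"
      using exists_other_index[OF assms(2)] by blast
    define v :: "('a, 'n) vec" where "v = (\<chi> i. if i = last_index then 1 else if i = p then unif ^ l else 0)"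
    have v: "v \<in> unit_sphere" "near l v"
      using absv_unif_pos[where 'a='a] by (auto simp: v_def unit_sphere_iff near_def)
    have "v $ p = unif ^ l"
      using p by (simp add: v_def)
    moreover have "absv (unif::'a) ^ Suc l < absv (unif::'a) ^ l"
      using absv_unif_pos absv_unif_less_1 by (intro power_strict_decreasing) auto
    ultimately have "\<not> near m v"
      using p by (auto simp: near_def l(1) not_le)
    then have "?\<phi> v = 0"
      by (simp add: char_fun_def)
    moreover have "?\<phi> v = char_fun \<omega> l v"
      using level_near[OF low v] char_fun_last_basis[OF assms(3), of m, where 'b='n] by simp
    moreover have "char_fun \<omega> l v = 1"
      using v character_one[OF assms(3)] by (auto simp: char_fun_def v_def)
    ultimately show False
      by simp
  qed
  ultimately show ?thesis
    by blast
qed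

section \<open>The reproducing kernel\<close>

context hermitian_form
begin

text \<open>
  Since \<open>\<Sum>c. c x * cnj (c x)\<close> is the value of the kernel on the diagonal, its mean is the trace
  of the identity, that is the dimension.
\<close>

lemma reproducing_basis:
  obtains C where "orthonormal C" "card C = cdim V"
    "\<forall>x. (\<Sum>c\<in>C. cscale (cnj (c x)) c) \<in> V"
    "\<forall>P\<in>V. \<forall>x. ip P (\<Sum>c\<in>C. cscale (cnj (c x)) c) = P x"
proof -
  obtain C where C: "orthonormal C" "cfun.span C = V" "card C = cdim V"
    by (rule orthonormal_basis)
  have CV: "c \<in> V" if "c \<in> C" for c
    using C(1) that by (auto simp: orthonormal_def)
  show ?thesis
  proof (rule that[OF C(1,3)]; intro allI ballI)
    fix x
    show "(\<Sum>c\<in>C. cscale (cnj (c x)) c) \<in> V"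
      by (intro mem_sum mem_scale CV)
  next
    fix P x assume P: "P \<in> V"
    have "ip P (\<Sum>c\<in>C. cscale (cnj (c x)) c) = (\<Sum>c\<in>C. ip P (cscale (cnj (c x)) c))"
      by (rule ip_sum_right) (auto intro: mem_scale CV P)
    also have "\<dots> = (\<Sum>c\<in>C. ip P c * c x)"
      by (intro sum.cong refl) (simp add: ip_scale_right[OF CV P] mult.commute)
    also have "\<dots> = proj C P x"
      by (simp add: proj_def sum_fun_apply cscale_apply)
    also have "proj C P = P"
      using C P by (intro proj_eq) auto
    finally show "ip P (\<Sum>c\<in>C. cscale (cnj (c x)) c) = P x" .
  qed
qed

lemma ip_eqI:
  assumes "f \<in> V" "g \<in> V" "\<And>P. P \<in> V \<Longrightarrow> ip P f = ip P g"
  shows "f = g"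
proof -
  have "ip (f - g) (f - g) = 0"
    using assms mem_diff[OF assms(1,2)] by (simp add: ip_diff_right)
  then show ?thesis
    using ip_definite[OF mem_diff[OF assms(1,2)]] by simp
qed

end

text \<open>The mean commutes with the finite sum over \<open>C\<close>, and a constant is its own
  mean. For an orthonormal \<open>C\<close> the left side counts \<open>C\<close>, which turns the
  diagonal value of the kernel into the dimension.\<close>

lemma sphere_inner_sum_const:
  fixes C :: "('a::nonarch_local_field ^ 'n::{finite,linorder} \<Rightarrow> complex) set"
  assumes "haar_prob M" "finite C" "C \<subseteq> inv_fun m"
    and const: "\<And>k. k \<in> GLO \<Longrightarrow> (\<Sum>c\<in>C. c (last_basis v* k) * cnj (c (last_basis v* k))) = z"
  shows "(\<Sum>c\<in>C. sphere_inner M c c) = z"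
proof -
  obtain R where R: "finite R" "R \<noteq> {}" "R \<subseteq> GLO"
    and avg: "\<forall>f\<in>inv_fun m. \<forall>g\<in>inv_fun m. sphere_inner M f g =
       (\<Sum>r\<in>R. f (last_basis v* r) * cnj (g (last_basis v* r))) / of_nat (card R)"
    by (rule sphere_average[OF assms(1), where m=m])
  have "(\<Sum>c\<in>C. sphere_inner M c c) =
      (\<Sum>c\<in>C. \<Sum>r\<in>R. c (last_basis v* r) * cnj (c (last_basis v* r))) / of_nat (card R)"
    unfolding sum_divide_distrib using assms(3) avg by (intro sum.cong) (auto simp: sum_divide_distrib)
  also have "(\<Sum>c\<in>C. \<Sum>r\<in>R. c (last_basis v* r) * cnj (c (last_basis v* r))) = (\<Sum>r\<in>R. z)"
    using R(3) const by (subst sum.swap) (intro sum.cong, auto)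
  also have "\<dots> / of_nat (card R) = z"
    using R by (simp add: card_eq_0_iff)
  finally show ?thesis .
qed

theorem corollary3p20:
  fixes M :: "('a::nonarch_local_field ^ 'n::{finite,linorder} ^ 'n::{finite,linorder}) measure"
    and \<omega> :: "'a \<Rightarrow> complex"
    and m :: nat
  assumes n_ge_2: "CARD('n) \<ge> 2"
    and haar: "haar_prob M"
    and character: "\<omega> \<in> unit_characters"
    and level: "m \<ge> cond_exp \<omega>"
  shows "(\<forall>k\<in>GLO. \<forall>Z. reproducing_kernel_at M (level_space M \<omega> m) (last_basis v* k) Z \<longleftrightarrow>
            Z = cscale (of_nat (cdim (level_space M \<omega> m)))
                  (right_translate (matrix_inv k) (spherical_fun M \<omega> m)))
       \<and> (\<forall>P\<in>level_space M \<omega> m. \<forall>k\<in>GLO. P (last_basis v* k) =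
            of_nat (cdim (level_space M \<omega> m)) * sphere_inner M (right_translate k P) (spherical_fun M \<omega> m))
       \<and> sphere_inner M (spherical_fun M \<omega> m) (spherical_fun M \<omega> m)
            = 1 / of_nat (cdim (level_space M \<omega> m))"
proof -
  let ?H = "level_space M \<omega> m"
  let ?d = "of_nat (cdim ?H) :: complex"
  interpret big: hermitian_form "inv_fun m :: (('a, 'n) vec \<Rightarrow> complex) set" "sphere_inner M"
    using haar by (rule hermitian_inv_fun)
  interpret hermitian_form ?H "sphere_inner M"
    using subspace_level_space[OF haar] level_space_inv_fun by (intro big.subform) auto
  obtain C where C: "orthonormal C" "card C = cdim ?H"
    and kern: "\<forall>x. (\<Sum>c\<in>C. cscale (cnj (c x)) c) \<in> ?H"
    and repr: "\<forall>P\<in>?H. \<forall>x. sphere_inner M P (\<Sum>c\<in>C. cscale (cnj (c x)) c) = P x"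
    by (rule reproducing_basis)
  define Z where "Z x = (\<Sum>c\<in>C. cscale (cnj (c x)) c)" for x
  have Z: "Z x \<in> ?H" "\<And>P. P \<in> ?H \<Longrightarrow> sphere_inner M P (Z x) = P x" for x
    using kern repr by (simp_all add: Z_def)
  have translate: "right_translate k P \<in> ?H" if "k \<in> GLO" "P \<in> ?H" for k P
    using right_translate_level_space[OF haar] that .
  \<comment> \<open>The kernel is determined by its inner products, and translation is unitary, so
    moving the point amounts to translating the kernel; the inverse appears as translation passes to
    the second argument.\<close>
  have Z_translate: "Z (x v* k) = right_translate (matrix_inv k) (Z x)" if k: "k \<in> GLO" for x k
  proof (rule ip_eqI)
    fix P assume P: "P \<in> ?H"
    have "sphere_inner M P (right_translate (matrix_inv k) (Z x)) =
        sphere_inner M (right_translate k P) (right_translate k (right_translate (matrix_inv k) (Z x)))"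
      using P k by (intro sphere_inner_right_translate[OF haar k, symmetric] level_space_inv_fun translate Z)
        (auto intro: translate Z)
    also have "\<dots> = sphere_inner M (right_translate k P) (Z x)"
      using k by (simp add: right_translate_inverse)
    also have "\<dots> = P (x v* k)"
      using Z(2)[OF translate[OF k P]] by (simp add: right_translate_def)
    finally show "sphere_inner M P (Z (x v* k)) = sphere_inner M P (right_translate (matrix_inv k) (Z x))"
      using Z(2)[OF P] by simp
  qed (use k in \<open>auto intro: Z translate\<close>)
  let ?e = "last_basis :: ('a, 'n) vec"
  have diag: "Z x x = (\<Sum>c\<in>C. c x * cnj (c x))" for x
    by (simp add: Z_def sum_fun_apply cscale_apply mult.commute)
  \<comment> \<open>Translating the kernel by the inverse of \<open>k\<close> cancels the shift of
    the point, so the diagonal is constant on the sphere.\<close>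
  have "Z (?e v* k) (?e v* k) = Z ?e ?e" if "k \<in> GLO" for k
    using that by (simp add: Z_translate) (simp add: right_translate_def)
  then have "(\<Sum>c\<in>C. sphere_inner M c c) = Z ?e ?e"
    using C(1) level_space_inv_fun[of _ M \<omega> m] unfolding diag orthonormal_def
    by (intro sphere_inner_sum_const[OF haar]) auto
  moreover have "(\<Sum>c\<in>C. sphere_inner M c c) = (\<Sum>c\<in>C. 1)"
    using C(1) by (intro sum.cong) (auto simp: orthonormal_def)
  ultimately have Z_diag: "Z ?e ?e = ?d"
    using C(2) by simp
  have mirab: "Z ?e (x v* k) = Z ?e x" if "k \<in> mirabolic" for x k
  proof -
    have k: "k \<in> GLO" and "?e v* k = ?e"
      using that by (simp_all add: mirabolic_GLO mirabolic_last_basis)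
    then have "Z ?e (x v* k) = right_translate (matrix_inv k) (Z ?e) (x v* k)"
      using Z_translate[OF k, of ?e] by simp
    then show ?thesis
      using k by (simp add: right_translate_def)
  qed
  \<comment> \<open>Dimension 0 would give the kernel at \<open>last_basis\<close> norm 0. By
    transitivity every function in the space would then vanish, against
    \<open>level_space_nonzero\<close>.\<close>
  have d: "?d \<noteq> 0"
  proof
    assume "?d = 0"
    then have "sphere_inner M (Z ?e) (Z ?e) = 0"
      using Z(2)[OF Z(1)] Z_diag by simp
    then have "Z ?e = 0"
      using ip_definite[OF Z(1)] by blast
    have "P x = 0" if P: "P \<in> ?H" for P x
    proof (cases "x \<in> unit_sphere")
      case True
      then obtain k where k: "k \<in> GLO" "x = ?e v* k"
        by (rule sphere_transitive)
      have "P x = sphere_inner M (right_translate k P) (Z ?e)"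
        using Z(2)[OF translate[OF k(1) P], of ?e] k(2) by (simp add: right_translate_def)
      then show ?thesis
        using ip_zero_right[OF translate[OF k(1) P]] \<open>Z ?e = 0\<close> by simp
    qed (use inv_fun_outside[OF level_space_inv_fun[OF P]] in simp)
    then show False
      using level_space_nonzero[OF haar n_ge_2 character level] by (auto simp: fun_eq_iff)
  qed
  define P0 where "P0 = cscale (1 / ?d) (Z ?e)"
  have P0: "P0 \<in> ?H" "\<And>x k. k \<in> mirabolic \<Longrightarrow> P0 (x v* k) = P0 x" "P0 ?e = 1"
    using Z(1) mirab Z_diag d by (auto simp: P0_def cscale_apply intro: mem_scale)
  have sph: "spherical_fun M \<omega> m = P0"
    unfolding spherical_fun_def
  proof (rule the_equality)
    show "P0 \<in> ?H \<and> (\<forall>x\<in>unit_sphere. \<forall>k\<in>mirabolic. P0 (x v* k) = P0 x) \<and> P0 ?e = 1"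
      using P0 by blast
    fix f assume f: "f \<in> ?H \<and> (\<forall>x\<in>unit_sphere. \<forall>k\<in>mirabolic. f (x v* k) = f x) \<and> f ?e = 1"
    have "f - P0 = 0"
    proof (rule mirabolic_invariant_eq_0[OF haar n_ge_2 character level])
      show "f - P0 \<in> ?H"
        using f P0(1) by (intro mem_diff) auto
    qed (use f P0 in auto)
    then show "f = P0"
      by simp
  qed
  have Z_P0: "Z ?e = cscale ?d P0"
    using d by (simp add: P0_def fun_eq_iff cscale_apply)
  have kernel: "Z (?e v* k) = cscale ?d (right_translate (matrix_inv k) P0)" if "k \<in> GLO" for k
    unfolding Z_translate[OF that] Z_P0 by (simp add: right_translate_def cscale_def)
  have unique: "reproducing_kernel_at M ?H x Y \<longleftrightarrow> Y = Z x" for x Y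
  proof
    assume "reproducing_kernel_at M ?H x Y"
    then show "Y = Z x"
      by (intro ip_eqI) (auto simp: reproducing_kernel_at_def Z)
  qed (simp add: reproducing_kernel_at_def Z)
  \<comment> \<open>Taking a translate for \<open>P\<close> gives the pointwise formula; taking
    \<open>P0\<close>, which is 1 at \<open>last_basis\<close>, gives its norm. The scalar
    \<open>1 / ?d\<close> is real, so conjugation leaves it unchanged.\<close>
  have inner: "sphere_inner M P P0 = P ?e / ?d" if "P \<in> ?H" for P
    using ip_scale_right[OF Z(1)[of ?e] that, of "1 / ?d"] Z(2)[OF that] by (simp add: P0_def)
  show ?thesis
    unfolding sph unique
    using d by (auto simp: kernel inner translate P0) (simp add: right_translate_def)
qed

end
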